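(* Let $P$ be a finite poset. Then the order congruence lattice $\mathcal{O}(P)$ is comodernistic, and hence has a $CL$-labeling (is $CL$-shellable).
   Context: A map $\varphi:P\to Q$ of posets is order-preserving if $x\le y$ implies $\varphi(x)\le\varphi(y)$. The level set partition of $\varphi$ is the partition of $P$ into the nonempty sets $\varphi^{-1}(q)$. The order congruence lattice $\mathcal{O}(P)$ is the subposet of the lattice $\Pi_P$ of all set partitions of $P$ (ordered by refinement, finer below) consisting of level set partitions of order-preserving maps from $P$ to posets (equivalently, to $\mathbb{Z}$). An element $m$ of a lattice $L$ is left-modular if $(x\vee m)\wedge y=x\vee(m\wedge y)$ for all $x<y$ in $L$; a lattice is comodernistic if every interval $[u,v]$ has a coatom that is left-modular in $[u,v]$. A $CL$-labeling is a labeling of rooted cover relations (a cover $x\lessdot y$ together with a maximal chain from $\hat0$ to $x$) by integers such that in every rooted interval (an interval $[x,y]$ with a fixed maximal chain from $\hat 0$ to $x$) there is a unique maximal chain whose label word is strictly increasing, and this chain is lexicographically strictly first among the maximal chains of that rooted interval. *)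

theory Defs
  imports "HOL-Algebra.Lattice" "HOL-Library.Disjoint_Sets"
begin

section \<open>The order congruence lattice\<close>

definition order_preserving_map ::
  "('a, 'c) gorder_scheme \<Rightarrow> ('b, 'd) gorder_scheme \<Rightarrow> ('a \<Rightarrow> 'b) \<Rightarrow> bool" where
  "order_preserving_map P Q \<phi> \<longleftrightarrow>
     partial_order P \<and> partial_order Q \<and> \<phi> \<in> carrier P \<rightarrow> carrier Q \<and> isotone P Q \<phi>"

definition level_set_partition ::
  "('a, 'c) gorder_scheme \<Rightarrow> ('b, 'd) gorder_scheme \<Rightarrow> ('a \<Rightarrow> 'b) \<Rightarrow> 'a set set" where
  "level_set_partition P Q \<phi> = (\<lambda>q. {p \<in> carrier P. \<phi> p = q}) ` carrier Q - {{}}"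

text \<open>
  HOL cannot quantify over target posets \<open>Q\<close> of every type inside a definition. The targets below
  have their elements in the type \<^typ>\<open>'a set\<close>; lemma \<open>level_set_partition_in_order_congruences\<close>
  shows that targets of any other type yield no further partitions, and lemma
  \<open>order_congruences_eq_int\<close> that for finite \<open>P\<close> the integers suffice.
\<close>

definition order_congruences :: "('a, 'c) gorder_scheme \<Rightarrow> 'a set set set" where
  "order_congruences P =
     {level_set_partition P Q \<phi> | (Q :: 'a set gorder) \<phi>. order_preserving_map P Q \<phi>}"

definition order_congruence_lattice :: "('a, 'c) gorder_scheme \<Rightarrow> 'a set set gorder" where
  "order_congruence_lattice P =
     \<lparr>carrier = order_congruences P, eq = (=), le = refines (carrier P)\<rparr>"


section \<open>Comodernistic lattices\<close>

definition interval :: "('a, 'c) gorder_scheme \<Rightarrow> 'a \<Rightarrow> 'a \<Rightarrow> ('a, 'c) gorder_scheme" where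
  "interval L u v = L\<lparr>carrier := \<lbrace>u..v\<rbrace>\<^bsub>L\<^esub>\<rparr>"

definition covers :: "('a, 'c) gorder_scheme \<Rightarrow> 'a \<Rightarrow> 'a \<Rightarrow> bool" where
  "covers L x y \<longleftrightarrow> x \<in> carrier L \<and> y \<in> carrier L \<and> x \<sqsubset>\<^bsub>L\<^esub> y \<and>
     \<not> (\<exists>z\<in>carrier L. x \<sqsubset>\<^bsub>L\<^esub> z \<and> z \<sqsubset>\<^bsub>L\<^esub> y)"

definition coatom :: "('a, 'c) gorder_scheme \<Rightarrow> 'a \<Rightarrow> bool" where
  "coatom L m \<longleftrightarrow> covers L m \<top>\<^bsub>L\<^esub>"

definition left_modular :: "('a, 'c) gorder_scheme \<Rightarrow> 'a \<Rightarrow> bool" where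
  "left_modular L m \<longleftrightarrow> m \<in> carrier L \<and>
     (\<forall>x\<in>carrier L. \<forall>y\<in>carrier L. x \<sqsubset>\<^bsub>L\<^esub> y \<longrightarrow>
        (x \<squnion>\<^bsub>L\<^esub> m) \<sqinter>\<^bsub>L\<^esub> y = x \<squnion>\<^bsub>L\<^esub> (m \<sqinter>\<^bsub>L\<^esub> y))"

text \<open>One-element intervals are excluded, as they have no coatoms at all.\<close>

definition comodernistic :: "('a, 'c) gorder_scheme \<Rightarrow> bool" where
  "comodernistic L \<longleftrightarrow> lattice L \<and>
     (\<forall>u\<in>carrier L. \<forall>v\<in>carrier L. u \<sqsubset>\<^bsub>L\<^esub> v \<longrightarrow>
        (\<exists>m. coatom (interval L u v) m \<and> left_modular (interval L u v) m))"


section \<open>CL-labelings\<close>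

text \<open>
  A maximal chain of the interval from \<open>x\<close> to \<open>y\<close> is the list of its elements in increasing order;
  see lemma \<open>maximal_chain_iff\<close> for the description as inclusion-maximal chain.
\<close>

definition maximal_chain :: "('a, 'c) gorder_scheme \<Rightarrow> 'a \<Rightarrow> 'a \<Rightarrow> 'a list \<Rightarrow> bool" where
  "maximal_chain L x y c \<longleftrightarrow> c \<noteq> [] \<and> set c \<subseteq> carrier L \<and> hd c = x \<and> last c = y \<and>
     successively (covers L) c"

text \<open>
  A rooted cover relation is a maximal chain \<open>r\<close> from the bottom to some \<open>x\<close> together with a cover
  \<open>y\<close> of \<open>x\<close>. As \<open>x\<close> is the last element of \<open>r\<close>, a labeling is a function of \<open>r\<close> and \<open>y\<close>.
  The list \<open>ys\<close> in \<open>label_word lab r ys\<close> continues \<open>r\<close>, so the word of a maximal chain \<open>c\<close> of an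
  interval rooted at \<open>r\<close> is \<open>label_word lab r (tl c)\<close>.
\<close>

type_synonym 'a rooted_labeling = "'a list \<Rightarrow> 'a \<Rightarrow> int"

fun label_word :: "'a rooted_labeling \<Rightarrow> 'a list \<Rightarrow> 'a list \<Rightarrow> int list" where
  "label_word lab r [] = []"
| "label_word lab r (y # ys) = lab r y # label_word lab (r @ [y]) ys"

definition increasing_chain ::
  "('a, 'c) gorder_scheme \<Rightarrow> 'a rooted_labeling \<Rightarrow> 'a list \<Rightarrow> 'a \<Rightarrow> 'a \<Rightarrow> 'a list \<Rightarrow> bool" where
  "increasing_chain L lab r x y c \<longleftrightarrow>
     maximal_chain L x y c \<and> sorted_wrt (<) (label_word lab r (tl c))"

definition CL_labeling :: "('a, 'c) gorder_scheme \<Rightarrow> 'a rooted_labeling \<Rightarrow> bool" where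
  "CL_labeling L lab \<longleftrightarrow>
     (\<forall>x\<in>carrier L. \<forall>y\<in>carrier L. \<forall>r. x \<sqsubseteq>\<^bsub>L\<^esub> y \<and> maximal_chain L \<bottom>\<^bsub>L\<^esub> x r \<longrightarrow>
        (\<exists>c. increasing_chain L lab r x y c \<and>
             (\<forall>d. increasing_chain L lab r x y d \<longrightarrow> d = c) \<and>
             (\<forall>d. maximal_chain L x y d \<and> d \<noteq> c \<longrightarrow>
                (label_word lab r (tl c), label_word lab r (tl d)) \<in> lexord {(a, b). a < b})))"

definition CL_shellable :: "('a, 'c) gorder_scheme \<Rightarrow> bool" where
  "CL_shellable L \<longleftrightarrow> (\<exists>lab. CL_labeling L lab)"


section \<open>Consistency of the definitions\<close>

lemma partial_orderI:
  assumes "eq Q = (=)"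
    and "\<And>x. x \<in> carrier Q \<Longrightarrow> le Q x x"
    and "\<And>x y. \<lbrakk>le Q x y; le Q y x; x \<in> carrier Q; y \<in> carrier Q\<rbrakk> \<Longrightarrow> x = y"
    and "\<And>x y z. \<lbrakk>le Q x y; le Q y z; x \<in> carrier Q; y \<in> carrier Q; z \<in> carrier Q\<rbrakk> \<Longrightarrow> le Q x z"
  shows "partial_order Q"
  by unfold_locales (use assms in \<open>auto\<close>)

lemma order_preserving_mapD:
  assumes "order_preserving_map P Q \<phi>" "x \<in> carrier P"
  shows "\<phi> x \<in> carrier Q" "y \<in> carrier P \<Longrightarrow> le P x y \<Longrightarrow> le Q (\<phi> x) (\<phi> y)"
  using assms by (auto simp: order_preserving_map_def isotone_def)

lemma order_preserving_mapI:
  assumes "partial_order P" "partial_order Q"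
    and "\<And>x. x \<in> carrier P \<Longrightarrow> \<phi> x \<in> carrier Q"
    and "\<And>x y. \<lbrakk>x \<in> carrier P; y \<in> carrier P; le P x y\<rbrakk> \<Longrightarrow> le Q (\<phi> x) (\<phi> y)"
  shows "order_preserving_map P Q \<phi>"
  using assms by (auto simp: order_preserving_map_def isotone_def partial_order_def)

lemma level_set_partition_eq:
  assumes "\<phi> \<in> carrier P \<rightarrow> carrier Q"
  shows "level_set_partition P Q \<phi> = (\<lambda>p. {p' \<in> carrier P. \<phi> p' = \<phi> p}) ` carrier P"
  using assms by (force simp: level_set_partition_def)

lemma partition_on_level_set_partition:
  assumes "\<phi> \<in> carrier P \<rightarrow> carrier Q"
  shows "partition_on (carrier P) (level_set_partition P Q \<phi>)"
  unfolding level_set_partition_eq[OF assms] by (force simp: partition_on_def disjoint_def)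

lemma level_set_partition_cong:
  assumes "\<phi> \<in> carrier P \<rightarrow> carrier Q" "\<psi> \<in> carrier P \<rightarrow> carrier R"
    and "\<And>p p'. \<lbrakk>p \<in> carrier P; p' \<in> carrier P\<rbrakk> \<Longrightarrow> \<phi> p = \<phi> p' \<longleftrightarrow> \<psi> p = \<psi> p'"
  shows "level_set_partition P Q \<phi> = level_set_partition P R \<psi>"
  unfolding level_set_partition_eq[OF assms(1)] level_set_partition_eq[OF assms(2)]
  by (rule image_cong) (use assms(3) in auto)

lemma level_set_partition_in_order_congruences:
  assumes "order_preserving_map P Q \<phi>"
  shows "level_set_partition P Q \<phi> \<in> order_congruences P"
proof -
  interpret Q: partial_order Q
    using assms by (simp add: order_preserving_map_def)
  define b where "b q = {p \<in> carrier P. \<phi> p = q}" for q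
  have inj: "inj_on b (\<phi> ` carrier P)"
    by (auto simp: inj_on_def b_def)
  define g where "g = inv_into (\<phi> ` carrier P) b"
  have g: "g (b (\<phi> p)) = \<phi> p" if "p \<in> carrier P" for p
    unfolding g_def using inj that by (intro inv_into_f_f) auto
  have P: "\<phi> p \<in> carrier Q" if "p \<in> carrier P" for p
    using order_preserving_mapD[OF assms that] by simp
  define R :: "'a set gorder" where
    "R = \<lparr>carrier = b ` \<phi> ` carrier P, eq = (=), le = (\<lambda>B C. le Q (g B) (g C))\<rparr>"
  have "partial_order R"
  proof (rule partial_orderI)
    fix x y assume "le R x y" "le R y x" "x \<in> carrier R" "y \<in> carrier R"
    then show "x = y"
      using P by (auto simp: R_def g dest: Q.le_antisym)
  next
    fix x y z
    assume "le R x y" "le R y z" "x \<in> carrier R" "y \<in> carrier R" "z \<in> carrier R"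
    then show "le R x z"
      using P by (auto simp: R_def g intro: Q.le_trans)
  qed (use P in \<open>auto simp: R_def g\<close>)
  then have R: "order_preserving_map P R (\<lambda>p. b (\<phi> p))"
    using assms order_preserving_mapD[OF assms]
    by (intro order_preserving_mapI) (auto simp: R_def g order_preserving_map_def)
  have "level_set_partition P Q \<phi> = level_set_partition P R (\<lambda>p. b (\<phi> p))"
    using assms R inj
    by (intro level_set_partition_cong) (auto simp: order_preserving_map_def inj_on_def)
  with R show ?thesis
    unfolding order_congruences_def by blast
qed

abbreviation int_order :: "int gorder" where
  "int_order \<equiv> \<lparr>carrier = UNIV, eq = (=), le = (\<le>)\<rparr>"

lemma linear_extension:
  assumes "partial_order Q" "finite X" "X \<subseteq> carrier Q"
  shows "\<exists>f :: 'q \<Rightarrow> int. inj_on f X \<and> (\<forall>x\<in>X. \<forall>y\<in>X. le Q x y \<longrightarrow> f x \<le> f y)"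
  using assms(2,3)
proof (induction "card X" arbitrary: X)
  case 0
  then show ?case by auto
next
  case (Suc n)
  interpret Q: partial_order Q by fact
  let ?lt = "\<lambda>x y. le Q x y \<and> x \<noteq> y"
  have "X \<noteq> {}"
    using Suc by auto
  have asym: "asymp_on X ?lt"
    unfolding asymp_on_def using Suc.prems(2) Q.le_antisym by (metis subsetD)
  have trans: "transp_on X ?lt"
  proof (rule transp_onI)
    fix x y z assume xyz: "x \<in> X" "y \<in> X" "z \<in> X" and lt: "?lt x y" "?lt y z"
    have "x \<in> carrier Q" "y \<in> carrier Q" "z \<in> carrier Q"
      using xyz Suc.prems(2) by auto
    then show "?lt x z"
      using lt Q.le_trans[of x y z] Q.le_antisym[of x y] by auto
  qed
  obtain m where m: "m \<in> X" "\<forall>x\<in>X. x \<noteq> m \<longrightarrow> \<not> ?lt m x"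
    using Finite_Set.bex_max_element[OF \<open>finite X\<close> asym trans \<open>X \<noteq> {}\<close>] by metis
  have "n = card (X - {m})" "finite (X - {m})" "X - {m} \<subseteq> carrier Q"
    using Suc.hyps(2) Suc.prems m(1) by auto
  then obtain f :: "'q \<Rightarrow> int" where
    f: "inj_on f (X - {m})" "\<forall>x\<in>X - {m}. \<forall>y\<in>X - {m}. le Q x y \<longrightarrow> f x \<le> f y"
    using Suc.hyps(1)[of "X - {m}"] by blast
  define k where "k = Max (insert 0 (f ` X)) + 1"
  have k: "f x < k" if "x \<in> X" for x
    using that Suc.prems(1) unfolding k_def
    by (meson Max_ge finite.insertI finite_imageI imageI insertI2 zle_add1_eq_le)
  have "inj_on (f(m := k)) X"
    using f(1) k by (auto simp: inj_on_def)
  moreover have "\<forall>x\<in>X. \<forall>y\<in>X. le Q x y \<longrightarrow> (f(m := k)) x \<le> (f(m := k)) y"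
    using f(2) k m(2) by (auto intro: less_imp_le)
  ultimately show ?case by blast
qed

lemma partial_order_int: "partial_order int_order"
  by (rule partial_orderI) auto

lemma order_congruences_eq_int:
  assumes "finite (carrier P)"
  shows "order_congruences P =
    {level_set_partition P int_order \<phi> | \<phi>. order_preserving_map P int_order \<phi>}"
    (is "_ = ?Z")
proof
  show "?Z \<subseteq> order_congruences P"
    using level_set_partition_in_order_congruences by blast
  show "order_congruences P \<subseteq> ?Z"
  proof
    fix \<pi> assume "\<pi> \<in> order_congruences P"
    then obtain Q :: "'a set gorder" and \<phi> where
      Q: "order_preserving_map P Q \<phi>" "\<pi> = level_set_partition P Q \<phi>"
      unfolding order_congruences_def by blast
    have "partial_order Q" "finite (\<phi> ` carrier P)" "\<phi> ` carrier P \<subseteq> carrier Q"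
      using Q(1) assms by (auto simp: order_preserving_map_def)
    from linear_extension[OF this] obtain f :: "'a set \<Rightarrow> int" where
      f: "inj_on f (\<phi> ` carrier P)"
         "\<forall>x\<in>\<phi> ` carrier P. \<forall>y\<in>\<phi> ` carrier P. le Q x y \<longrightarrow> f x \<le> f y"
      by blast
    have "order_preserving_map P int_order (f \<circ> \<phi>)"
      using Q(1) f(2) order_preserving_mapD[OF Q(1)] partial_order_int
      by (intro order_preserving_mapI) (auto simp: order_preserving_map_def)
    moreover have "\<pi> = level_set_partition P int_order (f \<circ> \<phi>)"
      unfolding Q(2) using Q(1) f(1)
      by (intro level_set_partition_cong) (auto simp: order_preserving_map_def inj_on_def)
    ultimately show "\<pi> \<in> ?Z" by blast
  qed
qed

lemma bottom_order_congruence_lattice: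
  assumes "partial_order P"
  shows "least (order_congruence_lattice P) ((\<lambda>p. {p}) ` carrier P)
           (carrier (order_congruence_lattice P))"
proof -
  have id: "order_preserving_map P P (\<lambda>p. p)"
    using assms by (auto intro: order_preserving_mapI)
  have eq: "level_set_partition P P (\<lambda>p. p) = (\<lambda>p. {p}) ` carrier P"
    by (subst level_set_partition_eq) auto
  have part: "partition_on (carrier P) \<pi>" if "\<pi> \<in> order_congruences P" for \<pi>
    using that partition_on_level_set_partition
    by (fastforce simp: order_congruences_def order_preserving_map_def)
  have mem: "(\<lambda>p. {p}) ` carrier P \<in> order_congruences P"
    using level_set_partition_in_order_congruences[OF id] eq by simp
  have "refines (carrier P) ((\<lambda>p. {p}) ` carrier P) \<pi>" if "\<pi> \<in> order_congruences P" for \<pi>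
    using part[OF that] part[OF mem] by (auto simp: refines_def partition_on_def)
  then show ?thesis
    using mem by (auto simp: least_def order_congruence_lattice_def)
qed

lemma maximal_chain_iff:
  assumes "partial_order L" "x \<in> carrier L" "y \<in> carrier L" "le L x y"
  shows "maximal_chain L x y c \<longleftrightarrow>
    sorted_wrt (\<lambda>a b. a \<sqsubset>\<^bsub>L\<^esub> b) c \<and> set c \<subseteq> \<lbrace>x..y\<rbrace>\<^bsub>L\<^esub> \<and>
    (\<forall>z\<in>\<lbrace>x..y\<rbrace>\<^bsub>L\<^esub>. (\<forall>w\<in>set c. le L z w \<or> le L w z) \<longrightarrow> z \<in> set c)"
    (is "_ \<longleftrightarrow> ?R x c")
proof
  interpret L: partial_order L by fact
  note less = L.lless_eq
  note int = at_least_at_most_def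
  show "?R x c" if "maximal_chain L x y c"
    using that
  proof (induction c arbitrary: x)
    case Nil
    then show ?case by (simp add: maximal_chain_def)
  next
    case (Cons a cs)
    show ?case
    proof (cases cs)
      case Nil
      with Cons.prems show ?thesis
        by (auto simp: maximal_chain_def int)
    next
      case (Cons b ds)
      have a: "a = x" and cov: "covers L x b" and b: "maximal_chain L b y cs"
        using Cons.prems Cons by (auto simp: maximal_chain_def)
      have ab: "x \<in> carrier L" "b \<in> carrier L" "le L x b" "x \<noteq> b"
        using cov by (auto simp: covers_def less)
      note IH = Cons.IH[OF b]
      have up: "w \<in> carrier L \<and> le L b w \<and> le L x w \<and> x \<noteq> w \<and> le L w y" if "w \<in> set cs" for w
        using IH that ab L.le_trans[of x b w] L.le_antisym[of x b] by (auto simp: int)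
      have xy: "le L x y"
        using up[of b] Cons Cons.prems ab L.le_trans[of x b y]
        by (metis last_in_set list.set_intros(1) maximal_chain_def subsetD)
      have "z \<in> set (a # cs)"
        if z: "z \<in> \<lbrace>x..y\<rbrace>\<^bsub>L\<^esub>" "\<forall>w\<in>set (a # cs). le L z w \<or> le L w z" for z
      proof (cases "le L b z")
        case True
        then show ?thesis using IH z by (auto simp: int)
      next
        case False
        then have "le L z b" "z \<noteq> b"
          using z ab Cons by auto
        then have "z = x"
          using cov z by (auto simp: covers_def less int)
        then show ?thesis by (simp add: a)
      qed
      moreover have "sorted_wrt (\<lambda>a b. a \<sqsubset>\<^bsub>L\<^esub> b) (a # cs)"
        using IH up by (auto simp: a less)
      moreover have "set (a # cs) \<subseteq> \<lbrace>x..y\<rbrace>\<^bsub>L\<^esub>"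
        using up ab xy by (auto simp: a int)
      ultimately show ?thesis by blast
    qed
  qed
  show "maximal_chain L x y c" if "?R x c"
    using that assms(2,4)
  proof (induction c arbitrary: x)
    case Nil
    then show ?case
      by (auto simp: int)
  next
    case (Cons a cs)
    have ai: "a \<in> carrier L" "le L x a" "le L a y"
      using Cons.prems by (auto simp: int)
    have csi: "w \<in> carrier L \<and> le L x w \<and> le L w y \<and> le L a w \<and> a \<noteq> w" if "w \<in> set cs" for w
      using Cons.prems that by (auto simp: int less)
    have max: "z \<in> set (a # cs)"
      if "z \<in> \<lbrace>x..y\<rbrace>\<^bsub>L\<^esub>" "\<forall>w\<in>set (a # cs). le L z w \<or> le L w z" for z
      using Cons.prems(1) that by blast
    have "x \<in> set (a # cs)"
      using ai csi Cons.prems by (intro max) (auto simp: int)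
    then have a: "a = x"
      using ai csi Cons.prems L.le_antisym by auto
    show ?case
    proof (cases cs)
      case Nil
      have "y \<in> set (a # cs)"
        using ai Nil assms(3) by (intro max) (auto simp: int a)
      then show ?thesis
        using Nil ai by (auto simp: maximal_chain_def a)
    next
      case (Cons b ds)
      have b: "b \<in> carrier L" "le L x b" "x \<noteq> b" "le L b y"
        using csi[of b] Cons by (auto simp: a)
      have bw: "le L b w" if "w \<in> set cs" for w
        using that Cons.prems(1) b by (auto simp: less Cons)
      have sub: "set cs \<subseteq> \<lbrace>b..y\<rbrace>\<^bsub>L\<^esub>"
        using bw csi by (auto simp: int)
      have mb: "z \<in> set cs"
        if z: "z \<in> \<lbrace>b..y\<rbrace>\<^bsub>L\<^esub>" "\<forall>w\<in>set cs. le L z w \<or> le L w z" for z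
      proof -
        have xz: "le L x z" "z \<in> carrier L" "x \<noteq> z"
          using z b ai a L.le_trans[of x b z] L.le_antisym[of x b] by (auto simp: int)
        then have "z \<in> set (a # cs)"
          using z by (intro max) (auto simp: int a)
        then show ?thesis using xz by (simp add: a)
      qed
      have "maximal_chain L b y cs"
        using Cons.prems(1) sub mb b by (intro Cons.IH) auto
      moreover have "covers L x b"
        unfolding covers_def
      proof (intro conjI notI)
        assume "\<exists>z\<in>carrier L. x \<sqsubset>\<^bsub>L\<^esub> z \<and> z \<sqsubset>\<^bsub>L\<^esub> b"
        then obtain z where z: "z \<in> carrier L" "le L x z" "x \<noteq> z" "le L z b" "z \<noteq> b"
          by (auto simp: less)
        have "z \<in> set (a # cs)"
        proof (rule max)
          show "z \<in> \<lbrace>x..y\<rbrace>\<^bsub>L\<^esub>"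
            using z b assms(3) L.le_trans[of z b y] by (auto simp: int)
          show "\<forall>w\<in>set (a # cs). le L z w \<or> le L w z"
            using z b bw csi L.le_trans[of z b] by (auto simp: a)
        qed
        then have "le L b z"
          using z bw by (auto simp: a)
        then show False
          using z b L.le_antisym by blast
      qed (use b ai a in \<open>auto simp: less\<close>)
      ultimately show ?thesis
        using ai Cons by (auto simp: maximal_chain_def a)
    qed
  qed
qed

end

theory Submission
  imports Defs "HOL-Algebra.Complete_Lattice"
begin

text \<open>
  A finite comodernistic lattice is labeled as follows. A root ending in \<open>x\<close> carries a chain
  \<open>\<top> = t\<^sub>0 > t\<^sub>1 > \<dots> > t\<^sub>n = x\<close> in which each \<open>t\<^sub>i\<^sub>+\<^sub>1\<close> is a left-modular coatom of \<open>[x, t\<^sub>i]\<close>,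
  and a cover \<open>a\<close> of \<open>x\<close> is labeled by minus the number of \<open>t\<^sub>i\<close> above it. Left modularity makes
  \<open>t\<^sub>j \<sqinter> y\<close>, for the largest \<open>j\<close> with \<open>t\<^sub>j \<sqinter> y \<noteq> x\<close>, the only cover of \<open>x\<close> below \<open>y\<close> with the
  least label. Since the chain of \<open>a\<close> extends the part above \<open>a\<close> of the chain of \<open>x\<close>, the next
  label exceeds that of \<open>a\<close> exactly if the next element is not below the lowest \<open>t\<^sub>i\<close> above \<open>a\<close>.
  So the chain that always takes the cover with the least label is increasing, and every other
  chain has a descent.

  In an interval \<open>[\<pi>, \<sigma>]\<close> of order congruences, a left-modular coatom is obtained from \<open>\<sigma>\<close> by
  splitting off, from a block of \<open>\<sigma>\<close> that contains several blocks of \<open>\<pi>\<close>, the topmost one of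
  these.
\<close>

section \<open>Covers and maximal chains\<close>

context partial_order
begin

lemma covers_carrier: "covers L x y \<Longrightarrow> x \<in> carrier L" "covers L x y \<Longrightarrow> y \<in> carrier L"
  and covers_imp_lless: "covers L x y \<Longrightarrow> x \<sqsubset> y"
  and covers_imp_le: "covers L x y \<Longrightarrow> x \<sqsubseteq> y"
  by (auto simp: covers_def lless_eq)

lemma covers_between:
  assumes "covers L x y" "z \<in> carrier L" "x \<sqsubseteq> z" "z \<sqsubseteq> y"
  shows "z = x \<or> z = y"
  using assms by (auto simp: covers_def lless_eq)

lemma card_interval_less:
  assumes "finite \<lbrace>x..y\<rbrace>" "x \<in> carrier L" "y \<in> carrier L" "x \<sqsubseteq> y"
    and "a \<in> carrier L" "b \<in> carrier L" "x \<sqsubseteq> a" "b \<sqsubseteq> y" "x \<noteq> a \<or> b \<noteq> y"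
  shows "card \<lbrace>a..b\<rbrace> < card \<lbrace>x..y\<rbrace>"
proof (rule psubset_card_mono)
  have "\<lbrace>a..b\<rbrace> \<subseteq> \<lbrace>x..y\<rbrace>"
    using assms by (auto simp: at_least_at_most_def intro: le_trans)
  moreover have "x \<in> \<lbrace>x..y\<rbrace>" "y \<in> \<lbrace>x..y\<rbrace>"
    using assms by (auto simp: at_least_at_most_def)
  moreover have "x \<notin> \<lbrace>a..b\<rbrace> \<or> y \<notin> \<lbrace>a..b\<rbrace>"
    using assms by (auto simp: at_least_at_most_def)
  ultimately show "\<lbrace>a..b\<rbrace> \<subset> \<lbrace>x..y\<rbrace>"
    by blast
qed (fact assms(1))

lemma ex_cover_below:
  assumes "finite \<lbrace>x..y\<rbrace>" "x \<in> carrier L" "y \<in> carrier L" "x \<sqsubset> y"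
  shows "\<exists>z. covers L x z \<and> z \<sqsubseteq> y"
proof -
  let ?P = "\<lambda>z. z \<in> carrier L \<and> x \<sqsubset> z \<and> z \<sqsubseteq> y"
  obtain z where z: "?P z" and min: "\<And>w. ?P w \<Longrightarrow> card \<lbrace>x..z\<rbrace> \<le> card \<lbrace>x..w\<rbrace>"
    using ex_has_least_nat[of ?P y "\<lambda>z. card \<lbrace>x..z\<rbrace>"] assms by auto
  have "\<not> (x \<sqsubset> w \<and> w \<sqsubset> z)" if w: "w \<in> carrier L" for w
  proof
    assume less: "x \<sqsubset> w \<and> w \<sqsubset> z"
    have "\<lbrace>x..z\<rbrace> \<subseteq> \<lbrace>x..y\<rbrace>"
      using z assms(3) by (auto simp: at_least_at_most_def intro: le_trans)
    then have "finite \<lbrace>x..z\<rbrace>"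
      using assms(1) by (rule finite_subset)
    then have "card \<lbrace>x..w\<rbrace> < card \<lbrace>x..z\<rbrace>"
      using z w less assms(2) by (intro card_interval_less) (auto simp: lless_eq)
    moreover have "w \<sqsubseteq> y"
      using z w less assms(3) le_trans[of w z y] by (auto simp: lless_eq)
    ultimately show False
      using min[of w] w less by auto
  qed
  then show ?thesis
    using z assms(2) by (auto simp: covers_def)
qed

lemma maximal_chain_cases:
  assumes "maximal_chain L x y c"
  obtains (single) "c = [x]" "x = y"
  | (Cons) a c' where "c = x # a # c'" "covers L x a" "maximal_chain L a y (a # c')"
  using assms by (cases c rule: remdups_adj.cases) (auto simp: maximal_chain_def)

lemma maximal_chain_snoc:
  assumes "maximal_chain L w x r" "covers L x a"
  shows "maximal_chain L w a (r @ [a])"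
  using assms by (auto simp: maximal_chain_def successively_append_iff covers_carrier)

lemma maximal_chain_carrier:
  assumes "maximal_chain L x y c"
  shows "x \<in> carrier L" "y \<in> carrier L"
  using assms by (auto simp: maximal_chain_def)

lemma maximal_chain_imp_le:
  assumes "maximal_chain L x y c"
  shows "x \<sqsubseteq> y"
  using assms
proof (induction c arbitrary: x)
  case Nil
  then show ?case by (simp add: maximal_chain_def)
next
  case (Cons b c)
  from Cons.prems show ?case
  proof (cases rule: maximal_chain_cases)
    case single
    then show ?thesis
      using maximal_chain_carrier[OF Cons.prems] by simp
  next
    case (Cons a c')
    then have "a \<sqsubseteq> y"
      using Cons.IH by simp
    with Cons show ?thesis
      using le_trans[of x a y] maximal_chain_carrier[OF Cons.prems]
      by (auto simp: covers_imp_le covers_carrier)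
  qed
qed

lemma maximal_chain_same_ends:
  assumes "maximal_chain L x x c"
  shows "c = [x]"
  using assms
proof (cases rule: maximal_chain_cases)
  case (Cons a c')
  then have "a \<sqsubseteq> x" "x \<sqsubset> a"
    by (simp_all add: maximal_chain_imp_le covers_imp_lless)
  with Cons show ?thesis
    by (auto simp: lless_eq covers_carrier)
qed


section \<open>A local criterion for CL-labelings\<close>

definition greedy_cover :: "'a rooted_labeling \<Rightarrow> 'a list \<Rightarrow> 'a \<Rightarrow> 'a \<Rightarrow> bool" where
  "greedy_cover lab r y a \<longleftrightarrow>
     covers L (last r) a \<and> a \<sqsubseteq> y \<and>
     (\<forall>z. covers L a z \<and> z \<sqsubseteq> y \<longrightarrow> lab r a < lab (r @ [a]) z) \<and>
     (\<forall>b. covers L (last r) b \<and> b \<sqsubseteq> y \<and> b \<noteq> a \<longrightarrow>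
        lab r a < lab r b \<and> (\<exists>z. covers L b z \<and> z \<sqsubseteq> y \<and> lab (r @ [b]) z \<le> lab r b))"

lemma increasing_chain_single:
  "x \<in> carrier L \<Longrightarrow> increasing_chain L lab r x x [x]"
  by (simp add: increasing_chain_def maximal_chain_def)

lemma increasing_chain_Cons_iff:
  "increasing_chain L lab r x y (x # a # c) \<longleftrightarrow>
     covers L x a \<and> increasing_chain L lab (r @ [a]) a y (a # c) \<and>
     (\<forall>l\<in>set (label_word lab (r @ [a]) c). lab r a < l)"
  by (auto simp: increasing_chain_def maximal_chain_def covers_carrier)

lemma increasing_chain_greedy_step:
  assumes "greedy_cover lab r y a" "last r = x" "increasing_chain L lab (r @ [a]) a y c"
  shows "increasing_chain L lab r x y (x # c)"
proof -
  have a: "covers L x a"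
    and label_less: "\<And>z. \<lbrakk>covers L a z; z \<sqsubseteq> y\<rbrakk> \<Longrightarrow> lab r a < lab (r @ [a]) z"
    using assms(1,2) by (auto simp: greedy_cover_def)
  have "maximal_chain L a y c"
    using assms(3) by (simp add: increasing_chain_def)
  then show ?thesis
  proof (cases rule: maximal_chain_cases)
    case single
    with a assms(3) show ?thesis
      by (simp add: increasing_chain_Cons_iff)
  next
    case (Cons z c')
    then have "lab r a < lab (r @ [a]) z"
      by (intro label_less maximal_chain_imp_le)
    with Cons a assms(3) show ?thesis
      by (auto simp: increasing_chain_Cons_iff)
  qed
qed

end

locale greedy_labeling = partial_order +
  fixes lab :: "'a rooted_labeling"
  assumes finite_carrier: "finite (carrier L)"
    and ex_greedy_cover:
      "\<lbrakk>maximal_chain L \<bottom> x r; y \<in> carrier L; x \<sqsubset> y\<rbrakk> \<Longrightarrow> \<exists>a. greedy_cover lab r y a"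
begin

lemma ex_increasing_chain:
  assumes "maximal_chain L \<bottom> x r" "y \<in> carrier L" "x \<sqsubseteq> y"
  shows "\<exists>c. increasing_chain L lab r x y c"
  using assms(1,3)
proof (induction "card \<lbrace>x..y\<rbrace>" arbitrary: x r rule: less_induct)
  case less
  note x = maximal_chain_carrier(2)[OF less.prems(1)]
  show ?case
  proof (cases "x = y")
    case True
    then show ?thesis
      using increasing_chain_single x by blast
  next
    case False
    with less.prems have "x \<sqsubset> y"
      by (simp add: lless_eq)
    then obtain a where greedy: "greedy_cover lab r y a"
      using ex_greedy_cover less.prems(1) assms(2) by blast
    have "last r = x"
      using less.prems(1) by (simp add: maximal_chain_def)
    with greedy have a: "covers L x a" "a \<sqsubseteq> y"
      by (simp_all add: greedy_cover_def)
    have "card \<lbrace>a..y\<rbrace> < card \<lbrace>x..y\<rbrace>"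
      using a x less.prems(2) assms(2) finite_carrier covers_imp_lless[OF a(1)]
      by (intro card_interval_less) (auto simp: covers_carrier lless_eq at_least_at_most_def)
    then obtain c where c: "increasing_chain L lab (r @ [a]) a y c"
      using less.hyps maximal_chain_snoc[OF less.prems(1) a(1)] a(2) by blast
    then show ?thesis
      using increasing_chain_greedy_step greedy \<open>last r = x\<close> by blast
  qed
qed

text \<open>
  If an increasing chain left \<open>x\<close> by a cover \<open>b\<close> that is not greedy, then some \<open>z\<close> above \<open>b\<close> would
  have a label of at most that of \<open>b\<close>. The next step being greedy, its label is no larger than
  that of \<open>z\<close>: a descent.
\<close>

lemma increasing_chain_imp_greedy_cover:
  assumes "maximal_chain L \<bottom> x r" "increasing_chain L lab r x y (x # b # c)"
  shows "greedy_cover lab r y b"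
  using assms
proof (induction "length c" arbitrary: c x r b rule: less_induct)
  case less
  have "covers L x b" and increasing: "increasing_chain L lab (r @ [b]) b y (b # c)"
    and label_less: "\<forall>l\<in>set (label_word lab (r @ [b]) c). lab r b < l"
    using less.prems(2) by (auto simp: increasing_chain_Cons_iff)
  have root: "maximal_chain L \<bottom> b (r @ [b])" "last r = x"
    using maximal_chain_snoc[OF less.prems(1) \<open>covers L x b\<close>] less.prems(1)
    by (auto simp: maximal_chain_def)
  have chain: "maximal_chain L b y (b # c)"
    using increasing by (simp add: increasing_chain_def)
  then have "b \<in> carrier L" "y \<in> carrier L" "b \<sqsubseteq> y"
    using maximal_chain_carrier maximal_chain_imp_le by blast+
  then have "x \<sqsubset> y"
    using \<open>covers L x b\<close> le_trans[of x b y] by (auto simp: covers_def lless_eq)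
  then obtain a where a: "greedy_cover lab r y a"
    using ex_greedy_cover[OF less.prems(1)] \<open>y \<in> carrier L\<close> by blast
  have "b = a"
  proof (rule ccontr)
    assume "b \<noteq> a"
    then obtain z where z: "covers L b z" "z \<sqsubseteq> y" "lab (r @ [b]) z \<le> lab r b"
      using a \<open>covers L x b\<close> \<open>b \<sqsubseteq> y\<close> root(2) by (auto simp: greedy_cover_def)
    from chain show False
    proof (cases rule: maximal_chain_cases)
      case single
      with z show False
        by (auto simp: covers_def lless_eq)
    next
      case (Cons z' c')
      then have "greedy_cover lab (r @ [b]) y z'"
        using less.hyps[of c' b "r @ [b]" z'] root(1) increasing by simp
      then have "lab (r @ [b]) z' \<le> lab (r @ [b]) z"
        using z by (cases "z = z'") (auto simp: greedy_cover_def)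
      moreover have "lab r b < lab (r @ [b]) z'"
        using label_less Cons by simp
      ultimately show False
        using z(3) by simp
    qed
  qed
  with a show ?case by simp
qed

lemma increasing_chain_lex_first:
  assumes "maximal_chain L \<bottom> x r" "increasing_chain L lab r x y c"
    and "maximal_chain L x y d" "d \<noteq> c"
  shows "(label_word lab r (tl c), label_word lab r (tl d)) \<in> lexord {(a, b). a < b}"
  using assms
proof (induction c arbitrary: x r d)
  case Nil
  then show ?case by (simp add: increasing_chain_def maximal_chain_def)
next
  case (Cons x' c)
  have c: "maximal_chain L x y (x' # c)"
    using Cons.prems(2) by (simp add: increasing_chain_def)
  have "x \<noteq> y"
    using c Cons.prems(3,4) maximal_chain_same_ends by blast
  then obtain a c' where c': "x' = x" "c = a # c'" "covers L x a"
    using c by (auto elim: maximal_chain_cases)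
  obtain b d' where d: "d = x # b # d'" "covers L x b" "maximal_chain L b y (b # d')"
    using Cons.prems(3) \<open>x \<noteq> y\<close> by (auto elim: maximal_chain_cases)
  show ?case
  proof (cases "b = a")
    case True
    have "increasing_chain L lab (r @ [a]) a y c"
      using Cons.prems(2) by (simp add: c' increasing_chain_Cons_iff)
    then have "(label_word lab (r @ [a]) (tl c), label_word lab (r @ [a]) d')
        \<in> lexord {(a, b). a < b}"
      using Cons.IH[of a "r @ [a]" "b # d'"] Cons.prems(1,4) maximal_chain_snoc c' d True by auto
    then show ?thesis
      using True by (simp add: c' d)
  next
    case False
    have "greedy_cover lab r y a"
      using Cons.prems(1,2) by (auto simp: c' intro: increasing_chain_imp_greedy_cover)
    moreover have "last r = x"
      using Cons.prems(1) by (simp add: maximal_chain_def)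
    ultimately have "lab r a < lab r b"
      using d False maximal_chain_imp_le by (auto simp: greedy_cover_def)
    then show ?thesis
      by (simp add: c' d)
  qed
qed

theorem CL_labeling: "CL_labeling L lab"
  unfolding CL_labeling_def
proof (intro ballI allI impI, elim conjE)
  fix x y r
  assume r: "maximal_chain L \<bottom> x r" and y: "y \<in> carrier L" "x \<sqsubseteq> y"
  obtain c where c: "increasing_chain L lab r x y c"
    using ex_increasing_chain[OF r y] by blast
  have lex: "(label_word lab r (tl c), label_word lab r (tl d)) \<in> lexord {(a, b). a < b}"
    if "increasing_chain L lab r x y c" "maximal_chain L x y d" "d \<noteq> c" for c d
    using increasing_chain_lex_first[OF r that] .
  have "d = c" if d: "increasing_chain L lab r x y d" for d
  proof (rule ccontr)
    assume "d \<noteq> c"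
    moreover have "maximal_chain L x y c" "maximal_chain L x y d"
      using c d by (simp_all add: increasing_chain_def)
    moreover have "asym {(a, b :: int). a < b}"
      by (auto intro: asymI)
    ultimately show False
      using lex c d by (metis asymD lexord_asym)
  qed
  with c lex show "\<exists>c. increasing_chain L lab r x y c \<and>
             (\<forall>d. increasing_chain L lab r x y d \<longrightarrow> d = c) \<and>
             (\<forall>d. maximal_chain L x y d \<and> d \<noteq> c \<longrightarrow>
                (label_word lab r (tl c), label_word lab r (tl d)) \<in> lexord {(a, b). a < b})"
    by blast
qed

end


section \<open>Left-modular coatoms of intervals\<close>

context partial_order
begin

lemma join_eqI:
  assumes "least L s (Upper L {x, y})"
  shows "x \<squnion> y = s"
  unfolding join_def Lattice.sup_def using assms least_unique
  by (metis (mono_tags, lifting) someI)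

lemma meet_eqI:
  assumes "greatest L i (Lower L {x, y})"
  shows "x \<sqinter> y = i"
  unfolding meet_def Lattice.inf_def using assms greatest_unique
  by (metis (mono_tags, lifting) someI)

lemma top_eqI:
  assumes "greatest L t (carrier L)"
  shows "\<top> = t"
  unfolding top_def using assms greatest_unique
  by (metis (mono_tags, lifting) someI)

lemma partial_order_interval: "partial_order (interval L u v)"
  by (rule partial_orderI)
     (auto simp: interval_def eq_is_equal at_least_at_most_def intro: le_trans)

lemma interval_simps:
  "carrier (interval L u v) = \<lbrace>u..v\<rbrace>"
  "x \<sqsubseteq>\<^bsub>interval L u v\<^esub> y \<longleftrightarrow> x \<sqsubseteq> y"
  "x \<sqsubset>\<^bsub>interval L u v\<^esub> y \<longleftrightarrow> x \<sqsubset> y"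
  by (simp_all add: interval_def lless_def)

lemma top_interval:
  assumes "u \<in> carrier L" "v \<in> carrier L" "u \<sqsubseteq> v"
  shows "\<top>\<^bsub>interval L u v\<^esub> = v"
  using assms
  by (intro partial_order.top_eqI partial_order_interval)
     (auto simp: greatest_def interval_simps at_least_at_most_def)

lemma coatom_interval_iff:
  assumes "u \<in> carrier L" "v \<in> carrier L" "u \<sqsubseteq> v"
  shows "coatom (interval L u v) m \<longleftrightarrow> u \<sqsubseteq> m \<and> covers L m v"
  using assms unfolding coatom_def top_interval[OF assms] covers_def
  by (auto simp: interval_simps at_least_at_most_def lless_eq intro: le_trans)

end

lemma (in upper_semilattice) join_in_interval:
  assumes "u \<in> carrier L" "v \<in> carrier L" "x \<in> \<lbrace>u..v\<rbrace>" "y \<in> \<lbrace>u..v\<rbrace>"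
  shows "x \<squnion> y \<in> \<lbrace>u..v\<rbrace>"
  using assms join_left[of x y] le_trans[of u x "x \<squnion> y"]
  by (auto simp: at_least_at_most_def intro: join_le)

lemma (in lower_semilattice) meet_in_interval:
  assumes "u \<in> carrier L" "v \<in> carrier L" "x \<in> \<lbrace>u..v\<rbrace>" "y \<in> \<lbrace>u..v\<rbrace>"
  shows "x \<sqinter> y \<in> \<lbrace>u..v\<rbrace>"
  using assms meet_left[of x y] le_trans[of "x \<sqinter> y" x v]
  by (auto simp: at_least_at_most_def intro: meet_le)

lemma (in upper_semilattice) join_interval:
  assumes "u \<in> carrier L" "v \<in> carrier L" "x \<in> \<lbrace>u..v\<rbrace>" "y \<in> \<lbrace>u..v\<rbrace>"
  shows "x \<squnion>\<^bsub>interval L u v\<^esub> y = x \<squnion> y"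
proof (intro partial_order.join_eqI partial_order_interval)
  show "least (interval L u v) (x \<squnion> y) (Upper (interval L u v) {x, y})"
    using assms join_in_interval[OF assms] at_least_at_most_closed[of u v]
    by (auto simp: least_def Upper_def interval_simps intro: join_left join_right join_le)
qed

lemma (in lower_semilattice) meet_interval:
  assumes "u \<in> carrier L" "v \<in> carrier L" "x \<in> \<lbrace>u..v\<rbrace>" "y \<in> \<lbrace>u..v\<rbrace>"
  shows "x \<sqinter>\<^bsub>interval L u v\<^esub> y = x \<sqinter> y"
proof (intro partial_order.meet_eqI partial_order_interval)
  show "greatest (interval L u v) (x \<sqinter> y) (Lower (interval L u v) {x, y})"
    using assms meet_in_interval[OF assms] at_least_at_most_closed[of u v]
    by (auto simp: greatest_def Lower_def interval_simps intro: meet_left meet_right meet_le)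
qed

context lattice
begin

lemma join_absorb: "\<lbrakk>x \<in> carrier L; y \<in> carrier L; x \<sqsubseteq> y\<rbrakk> \<Longrightarrow> x \<squnion> y = y"
  and meet_absorb: "\<lbrakk>x \<in> carrier L; y \<in> carrier L; x \<sqsubseteq> y\<rbrakk> \<Longrightarrow> y \<sqinter> x = x"
  using le_iff_meet[of x y] le_iff_join[of x y] by (simp_all add: meet_comm)

text \<open>
  For a coatom \<open>m\<close> of \<open>[u, v]\<close> the modular law is trivial if \<open>x \<sqsubseteq> m\<close>; otherwise \<open>x \<squnion> m = v\<close>, and
  the law reads as follows.
\<close>

definition left_modular_coatom :: "'a \<Rightarrow> 'a \<Rightarrow> 'a \<Rightarrow> bool" where
  "left_modular_coatom u v m \<longleftrightarrow> u \<sqsubseteq> m \<and> covers L m v \<and>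
     (\<forall>x\<in>\<lbrace>u..v\<rbrace>. \<forall>y\<in>\<lbrace>u..v\<rbrace>. x \<sqsubset> y \<and> \<not> x \<sqsubseteq> m \<longrightarrow> x \<squnion> (m \<sqinter> y) = y)"

lemma join_coatom:
  assumes "covers L m v" "x \<in> carrier L" "x \<sqsubseteq> v" "\<not> x \<sqsubseteq> m"
  shows "x \<squnion> m = v"
proof -
  have m: "m \<in> carrier L" "v \<in> carrier L" "m \<sqsubseteq> v"
    using assms(1) by (simp_all add: covers_carrier covers_imp_le)
  have "x \<squnion> m \<noteq> m"
    using assms(2,4) m(1) join_left by metis
  moreover have "m \<sqsubseteq> x \<squnion> m" "x \<squnion> m \<sqsubseteq> v"
    using assms m by (simp_all add: join_right join_le)
  ultimately show ?thesis
    using covers_between[OF assms(1), of "x \<squnion> m"] assms(2) m(1) by simp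
qed

lemma modular_law_coatom_iff:
  assumes m: "covers L m v" and x: "x \<in> carrier L" and y: "y \<in> carrier L"
    and xy: "x \<sqsubseteq> y" "y \<sqsubseteq> v"
  shows "(x \<squnion> m) \<sqinter> y = x \<squnion> (m \<sqinter> y) \<longleftrightarrow> x \<sqsubseteq> m \<or> x \<squnion> (m \<sqinter> y) = y"
proof (cases "x \<sqsubseteq> m")
  case True
  have "m \<in> carrier L"
    using m by (rule covers_carrier)
  with True x y xy show ?thesis
    by (simp add: join_absorb meet_le)
next
  case False
  have v: "v \<in> carrier L"
    using m by (rule covers_carrier)
  then have "x \<squnion> m = v"
    using False m x y xy le_trans[of x y v] by (intro join_coatom)
  with False v y xy show ?thesis
    by (auto simp: meet_absorb)
qed

lemma left_modular_coatom_iff_interval: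
  assumes "u \<in> carrier L" "v \<in> carrier L" "u \<sqsubseteq> v"
  shows "left_modular_coatom u v m \<longleftrightarrow>
    coatom (interval L u v) m \<and> left_modular (interval L u v) m"
proof (cases "u \<sqsubseteq> m \<and> covers L m v")
  case True
  then have m: "m \<in> \<lbrace>u..v\<rbrace>" "covers L m v"
    by (auto simp: at_least_at_most_def covers_def lless_eq)
  have "(x \<squnion>\<^bsub>interval L u v\<^esub> m) \<sqinter>\<^bsub>interval L u v\<^esub> y = x \<squnion>\<^bsub>interval L u v\<^esub> (m \<sqinter>\<^bsub>interval L u v\<^esub> y)
      \<longleftrightarrow> x \<sqsubseteq> m \<or> x \<squnion> (m \<sqinter> y) = y"
    if "x \<in> \<lbrace>u..v\<rbrace>" "y \<in> \<lbrace>u..v\<rbrace>" "x \<sqsubset> y" for x y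
  proof -
    have "x \<in> carrier L" "y \<in> carrier L" "x \<sqsubseteq> y" "y \<sqsubseteq> v"
      using that by (auto simp: at_least_at_most_def lless_eq)
    with m(2) have "(x \<squnion> m) \<sqinter> y = x \<squnion> (m \<sqinter> y) \<longleftrightarrow> x \<sqsubseteq> m \<or> x \<squnion> (m \<sqinter> y) = y"
      by (rule modular_law_coatom_iff)
    then show ?thesis
      using assms m(1) that
      by (simp add: join_interval meet_interval join_in_interval meet_in_interval)
  qed
  with True m(1) assms show ?thesis
    by (auto simp: left_modular_coatom_def left_modular_def coatom_interval_iff interval_simps)
qed (use assms in \<open>auto simp: left_modular_coatom_def coatom_interval_iff\<close>)

lemma left_modular_coatomD:
  assumes "left_modular_coatom u v m"
  shows "m \<in> carrier L" "v \<in> carrier L" "u \<sqsubseteq> m" "m \<sqsubset> v"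
  using assms by (auto simp: left_modular_coatom_def covers_def)

lemma left_modular_coatom_raise_bottom:
  assumes "left_modular_coatom u v m" "u \<in> carrier L" "a \<in> carrier L" "u \<sqsubseteq> a" "a \<sqsubseteq> m"
  shows "left_modular_coatom a v m"
proof -
  have "\<lbrace>a..v\<rbrace> \<subseteq> \<lbrace>u..v\<rbrace>"
    using assms by (auto simp: at_least_at_most_def intro: le_trans)
  then show ?thesis
    using assms unfolding left_modular_coatom_def by blast
qed

lemma covers_if_meet_left_modular_coatom:
  assumes m: "left_modular_coatom u v m"
    and u: "u \<in> carrier L" and y: "y \<in> carrier L" "u \<sqsubset> y" "y \<sqsubseteq> v" "m \<sqinter> y = u"
  shows "covers L u y"
  unfolding covers_def
proof (intro conjI notI u y)
  assume "\<exists>z\<in>carrier L. u \<sqsubset> z \<and> z \<sqsubset> y"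
  then obtain z where z: "z \<in> carrier L" "u \<sqsubseteq> z" "u \<noteq> z" "z \<sqsubseteq> y" "z \<sqsubset> y"
    by (auto simp: lless_eq)
  note mv = left_modular_coatomD[OF m]
  have "z \<sqsubseteq> v"
    using z y mv le_trans by blast
  moreover have "\<not> z \<sqsubseteq> m"
    using z y mv u meet_le[of z m y] by auto
  ultimately have "z \<squnion> (m \<sqinter> y) = y"
    using m y z unfolding left_modular_coatom_def
    by (auto simp: at_least_at_most_def lless_eq)
  moreover have "z \<squnion> u = z"
    using z u join_absorb[of u z] by (simp add: join_comm)
  ultimately show False
    using z y by (simp add: lless_eq)
qed

lemma covers_meet_left_modular_coatom:
  assumes m: "left_modular_coatom u v m" and u: "u \<in> carrier L" "u \<sqsubseteq> y"
    and y: "y \<in> carrier L" "v \<sqinter> y \<noteq> u" "m \<sqinter> y = u"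
  shows "covers L u (v \<sqinter> y)"
proof (rule covers_if_meet_left_modular_coatom[OF m u(1)])
  note mv = left_modular_coatomD[OF m]
  have "u \<sqsubseteq> v"
    using mv u(1) le_trans[of u m v] by (simp add: lless_eq)
  with mv u y show "v \<sqinter> y \<in> carrier L" "u \<sqsubset> v \<sqinter> y" "v \<sqinter> y \<sqsubseteq> v"
    by (auto simp: lless_eq meet_left meet_le)
  have "m \<sqinter> (v \<sqinter> y) = (v \<sqinter> m) \<sqinter> y"
    using mv y(1) meet_assoc[of m v y] meet_comm[of L m v] by simp
  then show "m \<sqinter> (v \<sqinter> y) = u"
    using mv y(3) by (simp add: meet_absorb lless_eq)
qed

end


section \<open>Finite comodernistic lattices are CL-shellable\<close>

lemma ex_adjacent_change:
  assumes "xs \<noteq> []" "Q (hd xs)" "\<not> Q (last xs)"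
  shows "\<exists>ys s t zs. xs = ys @ s # t # zs \<and> Q s \<and> \<not> Q t"
  using assms
proof (induction xs rule: induct_list012)
  case (3 a b xs)
  show ?case
  proof (cases "Q b")
    case True
    then obtain ys s t zs where "b # xs = ys @ s # t # zs" "Q s" "\<not> Q t"
      using "3.IH"(2) "3.prems" by auto
    then show ?thesis
      by (metis append_Cons)
  next
    case False
    with "3.prems" show ?thesis
      by (metis append_Nil list.sel(1))
  qed
qed simp_all

lemma (in upper_semilattice) finite_ex_greatest:
  assumes "finite (carrier L)" "carrier L \<noteq> {}"
  shows "\<exists>g. greatest L g (carrier L)"
proof -
  have "least L (\<Squnion>(carrier L)) (Upper L (carrier L))"
    using assms by (intro finite_sup_least) auto
  then have "greatest L (\<Squnion>(carrier L)) (carrier L)"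
    by (auto simp: greatest_def least_def Upper_def)
  then show ?thesis ..
qed

locale finite_comodernistic_lattice =
  lattice L + weak_partial_order_top L for L (structure) +
  assumes finite_carrier: "finite (carrier L)"
    and ex_left_modular_coatom:
      "\<lbrakk>u \<in> carrier L; v \<in> carrier L; u \<sqsubset> v\<rbrakk> \<Longrightarrow> \<exists>m. left_modular_coatom u v m"
begin

lemma finite_interval: "finite \<lbrace>x..y\<rbrace>"
  using finite_carrier at_least_at_most_closed by (rule finite_subset[rotated])

definition left_modular_chain :: "'a \<Rightarrow> 'a list \<Rightarrow> bool" where
  "left_modular_chain x ts \<longleftrightarrow>
     ts \<noteq> [] \<and> hd ts = \<top> \<and> set ts \<subseteq> \<lbrace>x..\<top>\<rbrace> \<and> successively (left_modular_coatom x) ts"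

lemma left_modular_chain_top: "x \<in> carrier L \<Longrightarrow> left_modular_chain x [\<top>]"
  by (simp add: left_modular_chain_def at_least_at_most_def)

lemma left_modular_chain_mem:
  assumes "left_modular_chain x ts" "t \<in> set ts"
  shows "t \<in> carrier L" "x \<sqsubseteq> t"
  using assms by (auto simp: left_modular_chain_def at_least_at_most_def)

lemma left_modular_chain_prefix:
  assumes "left_modular_chain x (ts @ us)" "ts \<noteq> []"
  shows "left_modular_chain x ts"
  using assms by (auto simp: left_modular_chain_def successively_append_iff)

lemma left_modular_chain_sorted:
  assumes "left_modular_chain x ts"
  shows "sorted_wrt (\<lambda>s t. t \<sqsubseteq> s) ts"
proof -
  have "successively (left_modular_coatom x) ts"
    using assms by (simp add: left_modular_chain_def)
  then have "successively (\<lambda>s t. t \<sqsubseteq> s) ts"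
    by (rule successively_mono) (simp add: left_modular_coatomD lless_imp_le)
  moreover have "r \<sqsubseteq> t" if "r \<sqsubseteq> s" "s \<sqsubseteq> t" "r \<in> set ts" "s \<in> set ts" "t \<in> set ts" for r s t
    using that left_modular_chain_mem(1)[OF assms] le_trans[of r s t] by simp
  ultimately show ?thesis
    by (subst successively_iff_sorted_wrt_strong[symmetric])
qed

lemma left_modular_chain_last_le:
  assumes "left_modular_chain x ts" "t \<in> set ts"
  shows "last ts \<sqsubseteq> t"
proof (cases ts rule: rev_cases)
  case (snoc us u)
  with assms show ?thesis
    using left_modular_chain_sorted[OF assms(1)] left_modular_chain_mem[OF assms]
    by (auto simp: sorted_wrt_append)
qed (use assms in simp)

lemma left_modular_chain_snoc:
  assumes "left_modular_chain x ts" "left_modular_coatom x (last ts) m"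
  shows "left_modular_chain x (ts @ [m])"
  using assms left_modular_coatomD[OF assms(2)]
  by (auto simp: left_modular_chain_def successively_append_iff at_least_at_most_def)

lemma ex_complete_left_modular_chain:
  assumes "x \<in> carrier L" "left_modular_chain x ts"
  shows "\<exists>us. left_modular_chain x (ts @ us) \<and> last (ts @ us) = x"
  using assms(2)
proof (induction "card \<lbrace>x..last ts\<rbrace>" arbitrary: ts rule: less_induct)
  case less
  show ?case
  proof (cases "last ts = x")
    case True
    with less.prems show ?thesis
      by (intro exI[of _ "[]"]) simp
  next
    case False
    have "last ts \<in> set ts"
      using less.prems by (simp add: left_modular_chain_def)
    then have last: "last ts \<in> carrier L" "x \<sqsubseteq> last ts"
      using less.prems by (simp_all add: left_modular_chain_mem)
    then obtain m where m: "left_modular_coatom x (last ts) m"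
      using ex_left_modular_coatom[of x "last ts"] False assms(1) by (auto simp: lless_eq)
    have "card \<lbrace>x..m\<rbrace> < card \<lbrace>x..last ts\<rbrace>"
      using left_modular_coatomD[OF m] last assms(1)
      by (intro card_interval_less finite_interval) (auto simp: lless_eq)
    then obtain us where "left_modular_chain x ((ts @ [m]) @ us)" "last ((ts @ [m]) @ us) = x"
      using less.hyps[of "ts @ [m]"] left_modular_chain_snoc[OF less.prems m] by auto
    then show ?thesis
      by (intro exI[of _ "m # us"]) simp
  qed
qed

definition part_above :: "'a \<Rightarrow> 'a list \<Rightarrow> 'a list" where
  "part_above a ts = takeWhile (\<lambda>t. a \<sqsubseteq> t) ts"

lemma part_above_mem: "t \<in> set (part_above a ts) \<Longrightarrow> t \<in> set ts \<and> a \<sqsubseteq> t"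
  unfolding part_above_def by (rule set_takeWhileD)

lemma left_modular_chain_part_above:
  assumes "left_modular_chain x ts" "x \<in> carrier L" "a \<in> carrier L" "x \<sqsubseteq> a"
  shows "left_modular_chain a (part_above a ts)"
proof -
  have "hd ts = \<top>" "ts \<noteq> []"
    using assms(1) by (auto simp: left_modular_chain_def)
  then have nonempty: "part_above a ts \<noteq> []" "hd (part_above a ts) = \<top>"
    using assms(3) by (cases ts; auto simp: part_above_def)+
  then have "left_modular_chain x (part_above a ts)"
    using assms(1) left_modular_chain_prefix[of x "part_above a ts" "dropWhile (\<lambda>t. a \<sqsubseteq> t) ts"]
    by (simp add: part_above_def)
  then have "successively (left_modular_coatom x) (part_above a ts)"
    by (simp add: left_modular_chain_def)
  then have "successively (left_modular_coatom a) (part_above a ts)"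
    by (rule successively_mono)
       (use assms part_above_mem in \<open>auto intro: left_modular_coatom_raise_bottom\<close>)
  moreover have "set (part_above a ts) \<subseteq> \<lbrace>a..\<top>\<rbrace>"
    using assms(1) left_modular_chain_mem part_above_mem by (auto simp: at_least_at_most_def)
  ultimately show ?thesis
    using nonempty by (simp add: left_modular_chain_def)
qed

lemma last_part_above:
  assumes "left_modular_chain x ts" "x \<in> carrier L" "a \<in> carrier L" "x \<sqsubseteq> a"
  shows "last (part_above a ts) \<in> set (part_above a ts)"
  using left_modular_chain_part_above[OF assms] by (simp add: left_modular_chain_def)

text \<open>
  When the root moves up to \<open>a\<close>, the part of the chain above \<open>a\<close> is kept, so that the labels of
  later covers can be compared with that of \<open>a\<close>; below it, any left-modular continuation down to
  \<open>a\<close> will do. Labels count from the top because the chains of different roots agree only in an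
  upper part.
\<close>

definition next_chain :: "'a list \<Rightarrow> 'a \<Rightarrow> 'a list" where
  "next_chain ts a = part_above a ts @
     (SOME us. left_modular_chain a (part_above a ts @ us) \<and> last (part_above a ts @ us) = a)"

definition root_chain :: "'a list \<Rightarrow> 'a list" where
  "root_chain r = foldl next_chain [\<top>] r"

definition chain_labeling :: "'a rooted_labeling" where
  "chain_labeling r a = - int (length (part_above a (root_chain r)))"

lemma left_modular_chain_next_chain:
  assumes "left_modular_chain x ts" "x \<in> carrier L" "a \<in> carrier L" "x \<sqsubseteq> a"
  shows "left_modular_chain a (next_chain ts a) \<and> last (next_chain ts a) = a"
  unfolding next_chain_def
  using ex_complete_left_modular_chain[OF assms(3) left_modular_chain_part_above[OF assms]]
  by (rule someI_ex)

lemma left_modular_chain_root_chain: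
  assumes "maximal_chain L w x r"
  shows "left_modular_chain x (root_chain r) \<and> last (root_chain r) = x"
  using assms
proof (induction r arbitrary: x rule: rev_induct)
  case Nil
  then show ?case by (simp add: maximal_chain_def)
next
  case (snoc a r)
  have a: "a = x" "x \<in> carrier L"
    using snoc.prems by (auto simp: maximal_chain_def)
  show ?case
  proof (cases "r = []")
    case True
    with a show ?thesis
      using left_modular_chain_next_chain[of x "[\<top>]" x] left_modular_chain_top
      by (simp add: root_chain_def)
  next
    case False
    then have "maximal_chain L w (last r) r" "covers L (last r) x"
      using snoc.prems a by (auto simp: maximal_chain_def successively_append_iff)
    then show ?thesis
      using snoc.IH[of "last r"] left_modular_chain_next_chain[of "last r" "root_chain r" x] a
      by (simp add: root_chain_def covers_carrier covers_imp_le)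
  qed
qed

lemma chain_labeling_snoc_le_iff:
  assumes r: "maximal_chain L w x r" and xa: "covers L x a" and z: "z \<in> carrier L"
  shows "chain_labeling (r @ [a]) z \<le> chain_labeling r a \<longleftrightarrow>
    z \<sqsubseteq> last (part_above a (root_chain r))"
proof -
  define U where "U = part_above a (root_chain r)"
  obtain us where us: "root_chain (r @ [a]) = U @ us"
    by (simp add: root_chain_def next_chain_def U_def)
  have U: "left_modular_chain a U"
    unfolding U_def using left_modular_chain_root_chain[OF r] xa
    by (auto intro: left_modular_chain_part_above simp: covers_carrier covers_imp_le)
  then have last: "last U \<in> set U"
    by (simp add: left_modular_chain_def)
  have "length U \<le> length (part_above z (U @ us)) \<longleftrightarrow> z \<sqsubseteq> last U"
  proof
    assume "z \<sqsubseteq> last U"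
    then have "z \<sqsubseteq> t" if "t \<in> set U" for t
      using that z last left_modular_chain_last_le[OF U that] left_modular_chain_mem[OF U]
        le_trans[of z "last U" t] by blast
    then show "length U \<le> length (part_above z (U @ us))"
      by (simp add: part_above_def)
  next
    show "z \<sqsubseteq> last U" if "length U \<le> length (part_above z (U @ us))"
    proof (rule ccontr)
      assume not_le: "\<not> z \<sqsubseteq> last U"
      then have "part_above z (U @ us) = takeWhile (\<lambda>t. z \<sqsubseteq> t) U"
        using last by (simp add: part_above_def takeWhile_append1)
      with that have "takeWhile (\<lambda>t. z \<sqsubseteq> t) U = U"
        by (metis length_takeWhile_le le_antisym takeWhile_eq_take take_all)
      with not_le last show False
        using set_takeWhileD by metis
    qed
  qed
  then show ?thesis
    by (simp add: chain_labeling_def us flip: U_def)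
qed

lemma left_modular_chain_meet_split:
  assumes ts: "left_modular_chain x ts" "last ts = x"
    and y: "x \<in> carrier L" "y \<in> carrier L" "x \<sqsubset> y"
  obtains pre t t' post where "ts = pre @ t # t' # post" "left_modular_coatom x t t'"
    and "t \<sqinter> y \<noteq> x" "t' \<sqinter> y = x"
proof -
  have "ts \<noteq> []" "hd ts = \<top>" and lm: "successively (left_modular_coatom x) ts"
    using ts(1) by (auto simp: left_modular_chain_def)
  moreover have "\<top> \<sqinter> y \<noteq> x" "x \<sqinter> y = x"
    using y meet_absorb[of y \<top>] meet_absorb[of x y] by (auto simp: lless_eq meet_comm)
  ultimately obtain pre t t' post where split: "ts = pre @ t # t' # post" "t \<sqinter> y \<noteq> x" "t' \<sqinter> y = x"
    using ex_adjacent_change[of ts "\<lambda>t. t \<sqinter> y \<noteq> x"] ts(2) by auto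
  have "left_modular_coatom x t t'"
    using lm unfolding split by (simp add: successively_append_iff)
  with split show thesis
    by (intro that)
qed

lemma part_above_eq_prefix:
  assumes ts: "left_modular_chain x (pre @ t # t' # post)"
    and a: "a \<in> carrier L" "a \<sqsubseteq> t" "\<not> a \<sqsubseteq> t'"
  shows "part_above a (pre @ t # t' # post) = pre @ [t]"
proof -
  have "a \<sqsubseteq> s" if "s \<in> set pre" for s
  proof -
    have "t \<sqsubseteq> s" "s \<in> carrier L" "t \<in> carrier L"
      using left_modular_chain_sorted[OF ts] left_modular_chain_mem[OF ts] that
      by (simp_all add: sorted_wrt_append)
    then show ?thesis
      using a le_trans[of a t s] by blast
  qed
  then show ?thesis
    using a by (simp add: part_above_def takeWhile_append2)
qed

lemma ex_cover_longest_part_above: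
  assumes ts: "left_modular_chain x ts" "last ts = x"
    and y: "x \<in> carrier L" "y \<in> carrier L" "x \<sqsubset> y"
  obtains a where "covers L x a" "last (part_above a ts) \<sqinter> y = a"
    and "\<And>b. \<lbrakk>covers L x b; b \<sqsubseteq> y; b \<noteq> a\<rbrakk> \<Longrightarrow>
      length (part_above b ts) < length (part_above a ts) \<and> a \<sqsubseteq> last (part_above b ts)"
proof -
  obtain pre t t' post where split: "ts = pre @ t # t' # post"
    and t: "left_modular_coatom x t t'" "t \<sqinter> y \<noteq> x" "t' \<sqinter> y = x"
    using left_modular_chain_meet_split[OF ts y] .
  define a where "a = t \<sqinter> y"
  have carrier: "t \<in> carrier L" "t' \<in> carrier L"
    using ts(1) by (simp_all add: split left_modular_chain_mem)
  have cover: "covers L x a"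
    unfolding a_def using t y by (intro covers_meet_left_modular_coatom) (auto simp: lless_eq)
  have not_le_t': "\<not> b \<sqsubseteq> t'" if "covers L x b" "b \<sqsubseteq> y" for b
    using that t(3) meet_le[of b t' y] carrier y by (auto simp: covers_def lless_eq)
  have a: "a \<in> carrier L" "a \<sqsubseteq> t" "a \<sqsubseteq> y"
    using carrier y by (simp_all add: a_def meet_left meet_right)
  have above_a: "part_above a ts = pre @ [t]"
    unfolding split using ts(1) a not_le_t'[OF cover]
    by (intro part_above_eq_prefix) (simp_all add: split)
  have "length (part_above b ts) < length (part_above a ts) \<and> a \<sqsubseteq> last (part_above b ts)"
    if b: "covers L x b" "b \<sqsubseteq> y" "b \<noteq> a" for b
  proof -
    have "\<not> b \<sqsubseteq> t"
    proof
      assume "b \<sqsubseteq> t"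
      then have "b \<sqsubseteq> a"
        using b carrier y unfolding a_def by (intro meet_le) (auto simp: covers_carrier)
      then show False
        using covers_between[OF cover, of b] b by (auto simp: covers_def lless_eq)
    qed
    then have above_b: "part_above b ts = takeWhile (\<lambda>s. b \<sqsubseteq> s) pre"
      by (simp add: part_above_def split takeWhile_tail)
    have "last (part_above b ts) \<in> set (part_above b ts)"
      using ts(1) y(1) b(1) by (intro last_part_above) (auto simp: covers_carrier covers_imp_le)
    then have "last (part_above b ts) \<in> set pre"
      unfolding above_b by (blast dest: set_takeWhileD)
    then show ?thesis
      using part_above_mem[of _ a ts]
      by (simp add: above_a above_b length_takeWhile_le less_Suc_eq_le)
  qed
  then show thesis
    using cover above_a by (intro that[of a]) (simp_all add: a_def)
qed

lemma ex_chain_labeling_descent: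
  assumes r: "maximal_chain L w x r" and y: "y \<in> carrier L"
    and a: "covers L x a" "a \<sqsubseteq> y" and b: "covers L x b" "b \<sqsubseteq> y" "b \<noteq> a"
    and le: "a \<sqsubseteq> last (part_above b (root_chain r))"
  shows "\<exists>z. covers L b z \<and> z \<sqsubseteq> y \<and> chain_labeling (r @ [b]) z \<le> chain_labeling r b"
proof -
  define t where "t = last (part_above b (root_chain r))"
  have chain: "left_modular_chain x (root_chain r)"
    using left_modular_chain_root_chain[OF r] by simp
  have carrier: "a \<in> carrier L" "b \<in> carrier L" "x \<in> carrier L"
    using a b by (simp_all add: covers_carrier)
  then have t: "t \<in> carrier L" "b \<sqsubseteq> t"
    using last_part_above[OF chain, of b] part_above_mem left_modular_chain_mem[OF chain]
      covers_imp_le[OF b(1)] unfolding t_def by blast+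
  have meet: "t \<sqinter> y \<in> carrier L" "a \<sqsubseteq> t \<sqinter> y" "b \<sqsubseteq> t \<sqinter> y"
    using carrier t y a b le by (simp_all add: meet_le flip: t_def)
  have "b \<noteq> t \<sqinter> y"
    using covers_between[OF b(1), of a] a b(3) meet(2) carrier covers_imp_lless[OF a(1)]
    by (auto simp: covers_imp_le lless_eq)
  then obtain z where z: "covers L b z" "z \<sqsubseteq> t \<sqinter> y"
    using ex_cover_below[of b "t \<sqinter> y"] meet carrier finite_interval by (auto simp: lless_eq)
  have "z \<in> carrier L"
    using z(1) by (rule covers_carrier)
  then have "z \<sqsubseteq> t" "z \<sqsubseteq> y"
    using z(2) t y meet meet_left[of t y] meet_right[of t y] le_trans[of z "t \<sqinter> y"] by blast+
  then show ?thesis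
    using chain_labeling_snoc_le_iff[OF r b(1) \<open>z \<in> carrier L\<close>] z(1) unfolding t_def by blast
qed

lemma ex_greedy_cover_chain_labeling:
  assumes r: "maximal_chain L w x r" and y: "y \<in> carrier L" "x \<sqsubset> y"
  shows "\<exists>a. greedy_cover chain_labeling r y a"
proof -
  have x: "x \<in> carrier L" "last r = x"
    using r by (auto simp: maximal_chain_carrier maximal_chain_def)
  have chain: "left_modular_chain x (root_chain r)" "last (root_chain r) = x"
    using left_modular_chain_root_chain[OF r] by simp_all
  then obtain a where a: "covers L x a" and meet: "last (part_above a (root_chain r)) \<sqinter> y = a"
    and minimal: "\<And>b. \<lbrakk>covers L x b; b \<sqsubseteq> y; b \<noteq> a\<rbrakk> \<Longrightarrow>
      length (part_above b (root_chain r)) < length (part_above a (root_chain r)) \<and>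
      a \<sqsubseteq> last (part_above b (root_chain r))"
    using ex_cover_longest_part_above[OF _ _ x(1) y] by metis
  have "last (part_above a (root_chain r)) \<in> carrier L"
    using last_part_above[OF chain(1) x(1)] part_above_mem left_modular_chain_mem[OF chain(1)] a
    by (blast intro: covers_carrier covers_imp_le)
  with y(1) meet have "a \<sqsubseteq> y" and le_a: "\<And>z. \<lbrakk>z \<in> carrier L; z \<sqsubseteq> last (part_above a (root_chain r));
      z \<sqsubseteq> y\<rbrakk> \<Longrightarrow> z \<sqsubseteq> a"
    using meet_right meet_le by metis+
  have "chain_labeling r a < chain_labeling (r @ [a]) z" if z: "covers L a z" "z \<sqsubseteq> y" for z
  proof -
    have "z \<in> carrier L" "\<not> z \<sqsubseteq> a"
      using z by (auto simp: covers_def lless_eq)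
    then show ?thesis
      using chain_labeling_snoc_le_iff[OF r a \<open>z \<in> carrier L\<close>] le_a z(2) by auto
  qed
  moreover have "\<exists>z. covers L b z \<and> z \<sqsubseteq> y \<and> chain_labeling (r @ [b]) z \<le> chain_labeling r b"
    if b: "covers L x b" "b \<sqsubseteq> y" "b \<noteq> a" for b
    using ex_chain_labeling_descent[OF r y(1) a \<open>a \<sqsubseteq> y\<close> b] minimal[OF b] by simp
  ultimately have "greedy_cover chain_labeling r y a"
    using a \<open>a \<sqsubseteq> y\<close> minimal by (simp add: greedy_cover_def x(2) chain_labeling_def)
  then show ?thesis ..
qed

lemma CL_labeling_chain_labeling: "CL_labeling L chain_labeling"
proof -
  interpret greedy_labeling L chain_labeling
    by unfold_locales (use finite_carrier ex_greedy_cover_chain_labeling in auto)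
  show ?thesis
    by (rule CL_labeling)
qed

end

theorem comodernistic_imp_CL_shellable:
  assumes "comodernistic L" "finite (carrier L)"
  shows "CL_shellable L"
proof (cases "carrier L = {}")
  case True
  then show ?thesis
    by (simp add: CL_shellable_def CL_labeling_def)
next
  case False
  interpret lattice L
    using assms by (simp add: comodernistic_def)
  have "\<exists>m. left_modular_coatom u v m"
    if "u \<in> carrier L" "v \<in> carrier L" "u \<sqsubset>\<^bsub>L\<^esub> v" for u v
    using assms(1) that left_modular_coatom_iff_interval[of u v]
    unfolding comodernistic_def by (metis lless_imp_le)
  then interpret finite_comodernistic_lattice L
    using assms(2) False finite_ex_greatest by unfold_locales auto
  show ?thesis
    using CL_labeling_chain_labeling by (auto simp: CL_shellable_def)
qed


section \<open>Partitions and their equivalence relations\<close>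

definition block_rel :: "'a set set \<Rightarrow> 'a rel" where
  "block_rel \<pi> = {(p, q). \<exists>B\<in>\<pi>. p \<in> B \<and> q \<in> B}"

lemma equiv_block_rel: "partition_on A \<pi> \<Longrightarrow> equiv A (block_rel \<pi>)"
  unfolding block_rel_def by (rule equiv_partition_on)

lemma block_rel_in_block_iff:
  assumes "partition_on A \<pi>" "B \<in> \<pi>" "(p, q) \<in> block_rel \<pi>"
  shows "p \<in> B \<longleftrightarrow> q \<in> B"
  using assms by (auto simp: block_rel_def dest!: partition_onD2 dest: disjointD)

lemma refines_iff_block_rel_subset:
  assumes \<pi>: "partition_on A \<pi>" and \<sigma>: "partition_on A \<sigma>"
  shows "refines A \<pi> \<sigma> \<longleftrightarrow> block_rel \<pi> \<subseteq> block_rel \<sigma>"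
proof
  show "block_rel \<pi> \<subseteq> block_rel \<sigma>" if "refines A \<pi> \<sigma>"
    using that unfolding refines_def block_rel_def by blast
  show "refines A \<pi> \<sigma>" if sub: "block_rel \<pi> \<subseteq> block_rel \<sigma>"
    unfolding refines_def
  proof (intro conjI ballI \<pi> \<sigma>)
    fix X assume "X \<in> \<pi>"
    then obtain p where "p \<in> X"
      using partition_onD3[OF \<pi>] by fastforce
    then have "(p, p) \<in> block_rel \<sigma>"
      using sub \<open>X \<in> \<pi>\<close> by (auto simp: block_rel_def)
    then obtain Y where "Y \<in> \<sigma>" "p \<in> Y"
      by (auto simp: block_rel_def)
    moreover have "(p, q) \<in> block_rel \<sigma>" if "q \<in> X" for q
      using sub \<open>X \<in> \<pi>\<close> \<open>p \<in> X\<close> that by (auto simp: block_rel_def)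
    ultimately show "\<exists>Y\<in>\<sigma>. X \<subseteq> Y"
      using block_rel_in_block_iff[OF \<sigma>] by blast
  qed
qed

definition kernel_on :: "'a set \<Rightarrow> ('a \<Rightarrow> 'b) \<Rightarrow> 'a rel" where
  "kernel_on A f = {(p, q) \<in> A \<times> A. f p = f q}"

definition split_off :: "'a set \<Rightarrow> 'a rel \<Rightarrow> 'a rel" where
  "split_off X R = {(p, q) \<in> R. p \<in> X \<longleftrightarrow> q \<in> X}"

text \<open>
  Taking \<open>E = R\<close>, this shows that splitting off \<open>X\<close> gives a coatom; taking for \<open>E\<close> the join of \<open>R\<close>
  with \<open>split_off X S\<close>, that this coatom is left-modular. The idea is that \<open>R\<close>, which relates some
  \<open>p \<in> X\<close> to some \<open>q \<notin> X\<close>, relates all of \<open>X\<close> to \<open>q\<close>.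
\<close>

lemma subset_if_split_off_subset:
  assumes equiv: "equiv A R" "equiv A S" "equiv A E"
    and X: "X \<times> X \<subseteq> R" and sub: "R \<subseteq> S" "R \<subseteq> E" "split_off X S \<subseteq> E"
    and crossing: "\<not> R \<subseteq> split_off X S"
  shows "S \<subseteq> E"
proof -
  have sym: "sym R" "sym S" "sym E" and trans: "trans R" "trans S" "trans E"
    using equiv by (auto simp: equiv_def)
  obtain p q where pq: "(p, q) \<in> R" "p \<in> X" "q \<notin> X"
    using crossing sub(1) symD[OF sym(1)] unfolding split_off_def by blast
  have across: "(s, t) \<in> E" if "(s, t) \<in> S" "s \<in> X" "t \<notin> X" for s t
  proof -
    have "(s, p) \<in> R"
      using X that pq by blast
    then have "(s, q) \<in> R"
      using pq(1) transD[OF trans(1)] by blast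
    then have "(q, t) \<in> S"
      using that(1) sub(1) symD[OF sym(2)] transD[OF trans(2)] by blast
    then have "(q, t) \<in> E"
      using pq(3) that(3) sub(3) by (auto simp: split_off_def)
    then show ?thesis
      using \<open>(s, q) \<in> R\<close> sub(2) transD[OF trans(3)] by blast
  qed
  show ?thesis
  proof (rule subrelI)
    fix s t assume "(s, t) \<in> S"
    then consider "(s, t) \<in> split_off X S" | "s \<in> X" "t \<notin> X" | "t \<in> X" "s \<notin> X"
      by (auto simp: split_off_def)
    then show "(s, t) \<in> E"
      using \<open>(s, t) \<in> S\<close> sub(3) across symD[OF sym(2)] symD[OF sym(3)] by cases blast+
  qed
qed

lemma ex_max_level_in_class:
  fixes f :: "'a \<Rightarrow> 'b :: linorder"
  assumes S: "equiv A S" and "finite A" and apart: "(p0, q0) \<in> S" "f p0 \<noteq> f q0"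
  shows "\<exists>X\<subseteq>A. (\<forall>p\<in>X. \<forall>q\<in>X. f p = f q) \<and>
    (\<forall>p\<in>X. \<forall>q. (p, q) \<in> S \<longrightarrow> f q \<le> f p \<and> (f q = f p \<longrightarrow> q \<in> X)) \<and>
    (\<exists>p\<in>X. \<exists>q. (p, q) \<in> S \<and> q \<notin> X)"
proof -
  define Y where "Y = S `` {p0}"
  define X where "X = {p \<in> Y. f p = Max (f ` Y)}"
  have Y: "Y \<subseteq> A" "p0 \<in> Y" "q0 \<in> Y"
    using apart(1) equiv_type[OF S] equiv_class_self[OF S, of p0] by (auto simp: Y_def)
  have Max_Y: "Max (f ` Y) \<in> f ` Y" "\<And>p. p \<in> Y \<Longrightarrow> f p \<le> Max (f ` Y)"
    using finite_subset[OF Y(1) \<open>finite A\<close>] Y(2) by (auto intro: Max_in)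
  have Y_class: "(p, q) \<in> S \<longleftrightarrow> q \<in> Y" if "p \<in> Y" for p q
    using that S unfolding Y_def equiv_def by (blast dest: symD transD)
  have "\<forall>p\<in>X. \<forall>q. (p, q) \<in> S \<longrightarrow> f q \<le> f p \<and> (f q = f p \<longrightarrow> q \<in> X)"
    using Y_class Max_Y(2) by (simp add: X_def)
  moreover have "\<exists>p\<in>X. \<exists>q. (p, q) \<in> S \<and> q \<notin> X"
  proof -
    obtain p where "p \<in> X"
      using Max_Y(1) by (auto simp: X_def)
    have "p0 \<notin> X \<or> q0 \<notin> X"
      using apart(2) by (auto simp: X_def)
    then obtain q where "q \<in> Y" "q \<notin> X"
      using Y by blast
    with \<open>p \<in> X\<close> Y_class[of p q] show ?thesis
      by (auto simp: X_def)
  qed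
  moreover have "X \<subseteq> A" "\<forall>p\<in>X. \<forall>q\<in>X. f p = f q"
    using Y(1) by (auto simp: X_def)
  ultimately show ?thesis
    by blast
qed


section \<open>The order congruence lattice\<close>

abbreviation OC :: "('a, 'c) gorder_scheme \<Rightarrow> 'a set set gorder" where
  "OC \<equiv> order_congruence_lattice"

lemma block_rel_level_set_partition:
  assumes "\<phi> \<in> carrier P \<rightarrow> carrier Q"
  shows "block_rel (level_set_partition P Q \<phi>) = kernel_on (carrier P) \<phi>"
  unfolding level_set_partition_eq[OF assms] by (auto simp: block_rel_def kernel_on_def)

lemma partition_on_OC: "\<pi> \<in> carrier (OC P) \<Longrightarrow> partition_on (carrier P) \<pi>"
  by (auto simp: order_congruence_lattice_def order_congruences_def order_preserving_map_def
      intro: partition_on_level_set_partition)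

lemma finite_OC: "finite (carrier P) \<Longrightarrow> finite (carrier (OC P))"
  using partition_on_OC by (intro finite_subset[OF _ finitely_many_partition_on]) auto

lemma le_OC_iff:
  assumes "\<pi> \<in> carrier (OC P)" "\<sigma> \<in> carrier (OC P)"
  shows "\<pi> \<sqsubseteq>\<^bsub>OC P\<^esub> \<sigma> \<longleftrightarrow> block_rel \<pi> \<subseteq> block_rel \<sigma>"
  using refines_iff_block_rel_subset[OF assms[THEN partition_on_OC]]
  by (simp add: order_congruence_lattice_def)

lemma partial_order_OC: "partial_order (OC P)"
proof (rule partial_orderI)
  show "\<pi> \<sqsubseteq>\<^bsub>OC P\<^esub> \<pi>" if "\<pi> \<in> carrier (OC P)" for \<pi>
    using that by (simp add: le_OC_iff)
qed (auto simp: order_congruence_lattice_def refines_asym intro: refines_trans)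

lemma lless_OC_iff:
  assumes "\<pi> \<in> carrier (OC P)" "\<sigma> \<in> carrier (OC P)"
  shows "\<pi> \<sqsubset>\<^bsub>OC P\<^esub> \<sigma> \<longleftrightarrow> block_rel \<pi> \<subset> block_rel \<sigma>"
proof -
  interpret partial_order "OC P"
    by (rule partial_order_OC)
  show ?thesis
    using assms le_antisym[of \<pi> \<sigma>] by (auto simp: lless_eq le_OC_iff)
qed

lemma ex_OC_level_set_partition:
  assumes "order_preserving_map P Q \<phi>"
  shows "\<exists>\<pi>\<in>carrier (OC P). block_rel \<pi> = kernel_on (carrier P) \<phi>"
  using level_set_partition_in_order_congruences[OF assms] assms
    block_rel_level_set_partition[of \<phi> P Q]
  by (auto simp: order_congruence_lattice_def order_preserving_map_def)

lemma OC_mapE: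
  fixes P :: "('a, 'c) gorder_scheme"
  assumes "\<pi> \<in> carrier (OC P)"
  obtains Q :: "'a set gorder" and \<phi> where "order_preserving_map P Q \<phi>"
    and "block_rel \<pi> = kernel_on (carrier P) \<phi>"
proof -
  obtain Q :: "'a set gorder" and \<phi>
    where "order_preserving_map P Q \<phi>" "\<pi> = level_set_partition P Q \<phi>"
    using assms by (auto simp: order_congruence_lattice_def order_congruences_def)
  then show thesis
    by (intro that) (auto simp: order_preserving_map_def block_rel_level_set_partition)
qed

lemma OC_int_mapE:
  assumes "finite (carrier P)" "\<pi> \<in> carrier (OC P)"
  obtains f where "order_preserving_map P int_order f"
    and "block_rel \<pi> = kernel_on (carrier P) f"
proof -
  obtain f where "order_preserving_map P int_order f" "\<pi> = level_set_partition P int_order f"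
    using assms by (auto simp: order_congruence_lattice_def order_congruences_eq_int)
  then show thesis
    by (intro that) (auto simp: block_rel_level_set_partition)
qed

lemma ex_OC_Int:
  fixes P :: "('a, 'c) gorder_scheme"
  assumes "\<pi> \<in> carrier (OC P)" "\<sigma> \<in> carrier (OC P)"
  shows "\<exists>\<rho>\<in>carrier (OC P). block_rel \<rho> = block_rel \<pi> \<inter> block_rel \<sigma>"
proof -
  obtain Q :: "'a set gorder" and \<phi> where \<phi>: "order_preserving_map P Q \<phi>"
    and \<pi>: "block_rel \<pi> = kernel_on (carrier P) \<phi>"
    using assms(1) by (rule OC_mapE)
  obtain R :: "'a set gorder" and \<psi> where \<psi>: "order_preserving_map P R \<psi>"
    and \<sigma>: "block_rel \<sigma> = kernel_on (carrier P) \<psi>"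
    using assms(2) by (rule OC_mapE)
  define QR :: "('a set \<times> 'a set) gorder" where
    "QR = \<lparr>carrier = carrier Q \<times> carrier R, eq = (=),
       le = (\<lambda>x y. fst x \<sqsubseteq>\<^bsub>Q\<^esub> fst y \<and> snd x \<sqsubseteq>\<^bsub>R\<^esub> snd y)\<rparr>"
  interpret Q: partial_order Q
    using \<phi> by (simp add: order_preserving_map_def)
  interpret R: partial_order R
    using \<psi> by (simp add: order_preserving_map_def)
  have "partial_order QR"
  proof (rule partial_orderI)
    show "x = y" if "le QR x y" "le QR y x" "x \<in> carrier QR" "y \<in> carrier QR" for x y
      using that Q.le_antisym[of "fst x" "fst y"] R.le_antisym[of "snd x" "snd y"]
      by (auto simp: QR_def prod_eq_iff)
  qed (auto simp: QR_def intro: Q.le_trans R.le_trans)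
  then have "order_preserving_map P QR (\<lambda>p. (\<phi> p, \<psi> p))"
    using \<phi> order_preserving_mapD[OF \<phi>] order_preserving_mapD[OF \<psi>]
    by (intro order_preserving_mapI) (auto simp: QR_def order_preserving_map_def)
  then obtain \<rho> where "\<rho> \<in> carrier (OC P)"
    "block_rel \<rho> = kernel_on (carrier P) (\<lambda>p. (\<phi> p, \<psi> p))"
    using ex_OC_level_set_partition by blast
  then show ?thesis
    by (intro bexI[of _ \<rho>]) (auto simp: \<pi> \<sigma> kernel_on_def)
qed

lemma greatest_Lower_OC:
  assumes "\<pi> \<in> carrier (OC P)" "\<sigma> \<in> carrier (OC P)"
    and "\<rho> \<in> carrier (OC P)" "block_rel \<rho> = block_rel \<pi> \<inter> block_rel \<sigma>"
  shows "greatest (OC P) \<rho> (Lower (OC P) {\<pi>, \<sigma>})"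
proof (rule greatest_LowerI)
  fix \<tau> assume "\<tau> \<in> Lower (OC P) {\<pi>, \<sigma>}"
  then have "\<tau> \<in> carrier (OC P)" "\<tau> \<sqsubseteq>\<^bsub>OC P\<^esub> \<pi>" "\<tau> \<sqsubseteq>\<^bsub>OC P\<^esub> \<sigma>"
    using assms(1,2) by (simp_all add: Lower_def)
  then show "\<tau> \<sqsubseteq>\<^bsub>OC P\<^esub> \<rho>"
    using assms by (simp add: le_OC_iff)
next
  fix \<tau> assume "\<tau> \<in> {\<pi>, \<sigma>}"
  then show "\<rho> \<sqsubseteq>\<^bsub>OC P\<^esub> \<tau>"
    using assms by (elim insertE emptyE) (simp_all add: le_OC_iff)
qed (use assms in simp_all)

lemma lower_semilattice_OC: "lower_semilattice (OC P)"
proof -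
  interpret partial_order "OC P"
    by (rule partial_order_OC)
  show ?thesis
  proof
    fix \<pi> \<sigma> assume \<pi>\<sigma>: "\<pi> \<in> carrier (OC P)" "\<sigma> \<in> carrier (OC P)"
    then obtain \<rho> where "\<rho> \<in> carrier (OC P)" "block_rel \<rho> = block_rel \<pi> \<inter> block_rel \<sigma>"
      using ex_OC_Int by blast
    then show "\<exists>\<rho>. greatest (OC P) \<rho> (Lower (OC P) {\<pi>, \<sigma>})"
      using \<pi>\<sigma> greatest_Lower_OC by blast
  qed
qed

lemma block_rel_meet_OC:
  assumes "\<pi> \<in> carrier (OC P)" "\<sigma> \<in> carrier (OC P)"
  shows "block_rel (\<pi> \<sqinter>\<^bsub>OC P\<^esub> \<sigma>) = block_rel \<pi> \<inter> block_rel \<sigma>"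
proof -
  obtain \<rho> where \<rho>: "\<rho> \<in> carrier (OC P)" "block_rel \<rho> = block_rel \<pi> \<inter> block_rel \<sigma>"
    using ex_OC_Int[OF assms] by blast
  then have "\<pi> \<sqinter>\<^bsub>OC P\<^esub> \<sigma> = \<rho>"
    using assms by (intro partial_order.meet_eqI partial_order_OC greatest_Lower_OC)
  with \<rho> show ?thesis by simp
qed

lemma ex_greatest_OC:
  assumes "partial_order P"
  shows "\<exists>\<tau>. greatest (OC P) \<tau> (carrier (OC P))"
proof -
  have "order_preserving_map P int_order (\<lambda>_. 0)"
    using assms partial_order_int by (intro order_preserving_mapI) auto
  from ex_OC_level_set_partition[OF this]
  obtain \<tau> where "\<tau> \<in> carrier (OC P)" "block_rel \<tau> = carrier P \<times> carrier P"
    by (auto simp: kernel_on_def)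
  moreover have "block_rel \<pi> \<subseteq> carrier P \<times> carrier P" if "\<pi> \<in> carrier (OC P)" for \<pi>
    using equiv_block_rel[OF partition_on_OC[OF that]] by (rule equiv_type)
  ultimately show ?thesis
    by (auto simp: greatest_def le_OC_iff)
qed

theorem complete_lattice_OC:
  assumes "partial_order P" "finite (carrier P)"
  shows "complete_lattice (OC P)"
proof -
  interpret lower_semilattice "OC P"
    by (rule lower_semilattice_OC)
  show ?thesis
  proof (rule complete_lattice_criterion1)
    fix A assume "A \<subseteq> carrier (OC P)" "A \<noteq> {}"
    then show "\<exists>i. greatest (OC P) i (Lower (OC P) A)"
      using finite_inf_greatest finite_subset finite_OC[OF assms(2)] by blast
  qed (rule ex_greatest_OC[OF assms(1)])
qed

lemma ex_OC_split_off:
  assumes "finite (carrier P)" "\<sigma> \<in> carrier (OC P)"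
    and upper: "\<And>p q. \<lbrakk>p \<in> X; q \<in> carrier P; p \<sqsubseteq>\<^bsub>P\<^esub> q; (p, q) \<in> block_rel \<sigma>\<rbrakk> \<Longrightarrow> q \<in> X"
  shows "\<exists>\<mu>\<in>carrier (OC P). block_rel \<mu> = split_off X (block_rel \<sigma>)"
proof -
  obtain g where g: "order_preserving_map P int_order g"
    and \<sigma>: "block_rel \<sigma> = kernel_on (carrier P) g"
    using assms(1,2) by (rule OC_int_mapE)
  define h where "h p = 2 * g p + of_bool (p \<in> X)" for p
  have "order_preserving_map P int_order h"
  proof (rule order_preserving_mapI)
    fix p q assume pq: "p \<in> carrier P" "q \<in> carrier P" "p \<sqsubseteq>\<^bsub>P\<^esub> q"
    then have "g p \<le> g q"
      using order_preserving_mapD[OF g] by simp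
    moreover have "q \<in> X" if "p \<in> X" "g p = g q"
      using that pq upper[of p q] by (simp add: \<sigma> kernel_on_def)
    ultimately show "h p \<sqsubseteq>\<^bsub>int_order\<^esub> h q"
      by (cases "g p = g q") (auto simp: h_def of_bool_def)
  qed (use g in \<open>auto simp: order_preserving_map_def\<close>)
  moreover have "h p = h q \<longleftrightarrow> g p = g q \<and> (p \<in> X \<longleftrightarrow> q \<in> X)" for p q
    by (cases "p \<in> X"; cases "q \<in> X"; simp add: h_def; presburger)
  ultimately show ?thesis
    using ex_OC_level_set_partition[of P int_order h] by (auto simp: split_off_def \<sigma> kernel_on_def)
qed

lemma ex_topmost_block:
  assumes fin: "finite (carrier P)" and \<pi>\<sigma>: "\<pi> \<in> carrier (OC P)" "\<sigma> \<in> carrier (OC P)" "\<pi> \<sqsubset>\<^bsub>OC P\<^esub> \<sigma>"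
  obtains X where "X \<times> X \<subseteq> block_rel \<pi>"
    and "\<And>p q. \<lbrakk>p \<in> X; q \<in> carrier P; p \<sqsubseteq>\<^bsub>P\<^esub> q; (p, q) \<in> block_rel \<sigma>\<rbrakk> \<Longrightarrow> q \<in> X"
    and "block_rel \<pi> \<subseteq> split_off X (block_rel \<sigma>)" "split_off X (block_rel \<sigma>) \<subset> block_rel \<sigma>"
proof -
  obtain f where f: "order_preserving_map P int_order f"
    and \<pi>: "block_rel \<pi> = kernel_on (carrier P) f"
    using fin \<pi>\<sigma>(1) by (rule OC_int_mapE)
  have equiv: "equiv (carrier P) (block_rel \<sigma>)"
    using \<pi>\<sigma>(2) by (intro equiv_block_rel partition_on_OC)
  have less: "block_rel \<pi> \<subset> block_rel \<sigma>"
    using \<pi>\<sigma> by (simp add: lless_OC_iff)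
  then obtain p0 q0 where apart: "(p0, q0) \<in> block_rel \<sigma>" "f p0 \<noteq> f q0"
    using equiv_type[OF equiv] by (auto simp: \<pi> kernel_on_def)
  obtain X where X: "X \<subseteq> carrier P" "\<forall>p\<in>X. \<forall>q\<in>X. f p = f q"
    and level: "\<forall>p\<in>X. \<forall>q. (p, q) \<in> block_rel \<sigma> \<longrightarrow> f q \<le> f p \<and> (f q = f p \<longrightarrow> q \<in> X)"
    and proper: "\<exists>p\<in>X. \<exists>q. (p, q) \<in> block_rel \<sigma> \<and> q \<notin> X"
    using ex_max_level_in_class[OF equiv fin apart] by blast
  show thesis
  proof (rule that)
    show "X \<times> X \<subseteq> block_rel \<pi>"
      using X by (auto simp: \<pi> kernel_on_def)
    show "q \<in> X" if "p \<in> X" "q \<in> carrier P" "p \<sqsubseteq>\<^bsub>P\<^esub> q" "(p, q) \<in> block_rel \<sigma>" for p q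
      using that X(1) level[rule_format, of p q] order_preserving_mapD(2)[OF f, of p q] by auto
    show "block_rel \<pi> \<subseteq> split_off X (block_rel \<sigma>)"
    proof (rule subrelI)
      fix p q assume "(p, q) \<in> block_rel \<pi>"
      then have "f p = f q" "(p, q) \<in> block_rel \<sigma>" "(q, p) \<in> block_rel \<sigma>"
        using less equiv by (auto simp: \<pi> kernel_on_def equiv_def dest: symD)
      then show "(p, q) \<in> split_off X (block_rel \<sigma>)"
        using level[rule_format, of p q] level[rule_format, of q p] by (auto simp: split_off_def)
    qed
    show "split_off X (block_rel \<sigma>) \<subset> block_rel \<sigma>"
      using proper unfolding split_off_def by blast
  qed
qed

lemma le_OC_if_split_off_le:
  assumes carrier: "m \<in> carrier (OC P)" "v \<in> carrier (OC P)" "x \<in> carrier (OC P)"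
      "y \<in> carrier (OC P)" "e \<in> carrier (OC P)"
    and m: "block_rel m = split_off X (block_rel v)" and X: "X \<times> X \<subseteq> block_rel x"
    and le: "x \<sqsubseteq>\<^bsub>OC P\<^esub> y" "y \<sqsubseteq>\<^bsub>OC P\<^esub> v" "x \<sqsubseteq>\<^bsub>OC P\<^esub> e" "m \<sqinter>\<^bsub>OC P\<^esub> y \<sqsubseteq>\<^bsub>OC P\<^esub> e"
    and not_le: "\<not> x \<sqsubseteq>\<^bsub>OC P\<^esub> m"
  shows "y \<sqsubseteq>\<^bsub>OC P\<^esub> e"
proof -
  interpret lower_semilattice "OC P"
    by (rule lower_semilattice_OC)
  have sub: "block_rel x \<subseteq> block_rel y" "block_rel y \<subseteq> block_rel v" "block_rel x \<subseteq> block_rel e"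
    using carrier le by (simp_all add: le_OC_iff)
  have "block_rel (m \<sqinter>\<^bsub>OC P\<^esub> y) = split_off X (block_rel y)"
    using carrier sub by (auto simp: block_rel_meet_OC m split_off_def)
  moreover have "block_rel (m \<sqinter>\<^bsub>OC P\<^esub> y) \<subseteq> block_rel e"
    using carrier le(4) by (simp add: le_OC_iff)
  moreover have "\<not> block_rel x \<subseteq> split_off X (block_rel y)"
    using carrier not_le sub(2) by (auto simp: le_OC_iff m split_off_def)
  ultimately have "block_rel y \<subseteq> block_rel e"
    using subset_if_split_off_subset[of "carrier P" "block_rel x" "block_rel y" "block_rel e" X]
      equiv_block_rel partition_on_OC carrier X sub by metis
  with carrier show ?thesis
    by (simp add: le_OC_iff)
qed

lemma covers_OC_split_off:
  assumes "m \<in> carrier (OC P)" "v \<in> carrier (OC P)" "m \<sqsubset>\<^bsub>OC P\<^esub> v"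
    and m: "block_rel m = split_off X (block_rel v)" and X: "X \<times> X \<subseteq> block_rel m"
  shows "covers (OC P) m v"
proof -
  interpret lower_semilattice "OC P"
    by (rule lower_semilattice_OC)
  have "\<not> (m \<sqsubset>\<^bsub>OC P\<^esub> z \<and> z \<sqsubset>\<^bsub>OC P\<^esub> v)" if z: "z \<in> carrier (OC P)" for z
  proof
    assume "m \<sqsubset>\<^bsub>OC P\<^esub> z \<and> z \<sqsubset>\<^bsub>OC P\<^esub> v"
    then have rel: "block_rel m \<subset> block_rel z" "block_rel z \<subset> block_rel v"
      using z assms by (simp_all add: lless_OC_iff)
    then have "v \<sqsubseteq>\<^bsub>OC P\<^esub> z"
      using z assms X
      by (intro le_OC_if_split_off_le[of m P v z v z X]) (auto simp: le_OC_iff block_rel_meet_OC)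
    with rel(2) z assms(2) show False
      by (simp add: le_OC_iff)
  qed
  then show ?thesis
    using assms by (auto simp: covers_def)
qed

theorem ex_left_modular_coatom_OC:
  assumes P: "partial_order P" "finite (carrier P)"
    and uv: "u \<in> carrier (OC P)" "v \<in> carrier (OC P)" "u \<sqsubset>\<^bsub>OC P\<^esub> v"
  shows "\<exists>m. lattice.left_modular_coatom (OC P) u v m"
proof -
  interpret complete_lattice "OC P"
    using P by (rule complete_lattice_OC)
  obtain X where X: "X \<times> X \<subseteq> block_rel u"
    and upper: "\<And>p q. \<lbrakk>p \<in> X; q \<in> carrier P; p \<sqsubseteq>\<^bsub>P\<^esub> q; (p, q) \<in> block_rel v\<rbrakk> \<Longrightarrow> q \<in> X"
    and split: "block_rel u \<subseteq> split_off X (block_rel v)" "split_off X (block_rel v) \<subset> block_rel v"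
    using ex_topmost_block[OF P(2) uv] by blast
  obtain m where m: "m \<in> carrier (OC P)" "block_rel m = split_off X (block_rel v)"
    using ex_OC_split_off[of P v X] P(2) uv(2) upper by blast
  have um: "u \<sqsubseteq>\<^bsub>OC P\<^esub> m" and mv: "m \<sqsubset>\<^bsub>OC P\<^esub> v"
    using m uv split by (simp_all add: le_OC_iff lless_OC_iff)
  have X_above: "X \<times> X \<subseteq> block_rel x" if "x \<in> carrier (OC P)" "u \<sqsubseteq>\<^bsub>OC P\<^esub> x" for x
    using that X uv(1) by (auto simp: le_OC_iff)
  have "covers (OC P) m v"
    using m uv(1,2) mv um X_above by (intro covers_OC_split_off) auto
  moreover have "x \<squnion>\<^bsub>OC P\<^esub> (m \<sqinter>\<^bsub>OC P\<^esub> y) = y"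
    if xy: "x \<in> \<lbrace>u..v\<rbrace>\<^bsub>OC P\<^esub>" "y \<in> \<lbrace>u..v\<rbrace>\<^bsub>OC P\<^esub>" "x \<sqsubset>\<^bsub>OC P\<^esub> y" "\<not> x \<sqsubseteq>\<^bsub>OC P\<^esub> m" for x y
  proof (rule le_antisym)
    let ?w = "x \<squnion>\<^bsub>OC P\<^esub> (m \<sqinter>\<^bsub>OC P\<^esub> y)"
    have carrier: "x \<in> carrier (OC P)" "y \<in> carrier (OC P)"
      and le: "u \<sqsubseteq>\<^bsub>OC P\<^esub> x" "x \<sqsubseteq>\<^bsub>OC P\<^esub> y" "y \<sqsubseteq>\<^bsub>OC P\<^esub> v"
      using xy by (simp_all add: at_least_at_most_def lless_imp_le)
    then show "?w \<in> carrier (OC P)" "y \<in> carrier (OC P)" "?w \<sqsubseteq>\<^bsub>OC P\<^esub> y"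
      using m(1) by (simp_all add: join_le meet_right)
    show "y \<sqsubseteq>\<^bsub>OC P\<^esub> ?w"
      using carrier le m uv(2) xy(4) X_above
      by (intro le_OC_if_split_off_le[of m P v x y ?w X]) (simp_all add: join_left join_right)
  qed
  ultimately show ?thesis
    using um unfolding left_modular_coatom_def by blast
qed

theorem comodernistic_OC:
  assumes "partial_order P" "finite (carrier P)"
  shows "comodernistic (OC P)"
proof -
  interpret complete_lattice "OC P"
    using assms by (rule complete_lattice_OC)
  show ?thesis
    using ex_left_modular_coatom_OC[OF assms] left_modular_coatom_iff_interval lattice_axioms
      lless_imp_le
    unfolding comodernistic_def by metis
qed

theorem theorem1p5:
  fixes P :: "'a gorder"
  assumes "partial_order P" and "finite (carrier P)"
  shows "comodernistic (order_congruence_lattice P) \<and> CL_shellable (order_congruence_lattice P)"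
proof
  show "comodernistic (order_congruence_lattice P)"
    using assms by (rule comodernistic_OC)
  then show "CL_shellable (order_congruence_lattice P)"
    using finite_OC[OF assms(2)] by (rule comodernistic_imp_CL_shellable)
qed

end
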